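(* Let $A=(a_{i,k})$, $B=(b_{\nu,k})$, $C=(c_{j,k})$ be Köthe matrices, and let $\lambda^{m_1},\lambda^{m_2}\in\{\lambda,\lambda^\infty_0\}$ and $\lambda^{m_3}\in\{\lambda,\lambda^\infty\}$. Then $(\lambda^{m_1}(A),\lambda^{m_2}(B),\lambda^{m_3}(C))\in\mathfrak{TF}$ if and only if there exists a nondecreasing function $S:\mathbb{N}\to\mathbb{N}$ such that for every nondecreasing function $\phi:\mathbb{N}\to\mathbb{N}$ the following holds: there exists $k_0\in\mathbb{N}$ such that for every $k\ge k_0$ there exist $q_k\in\mathbb{N}$ and $C_k>0$ with $$\frac{c_{j,k}}{a_{i,S(k)}}\le C_k\max_{1\le q\le q_k}\frac{b_{\nu,q}}{a_{i,\phi(q)}}\,\max_{1\le q\le q_k}\frac{c_{j,q}}{b_{\nu,\phi(q)}}$$ for every $i,j,\nu\in\mathbb{N}$.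
   Context: $\mathbb{N}=\{1,2,3,\dots\}$. Fréchet spaces are graded, i.e. equipped with a fixed increasing sequence of seminorms $(\|\cdot\|_k)_{k\in\mathbb{N}}$ defining the topology. A Köthe matrix is a matrix $(a_{n,k})_{n,k\in\mathbb{N}}$ of non-negative scalars with $a_{n,k}\le a_{n,k+1}$ for all $n,k$, such that for every $n$ there is $k$ with $a_{n,k}>0$. With $\mathbb{K}=\mathbb{R}$ or $\mathbb{C}$: $\lambda(A)=\{x\in\mathbb{K}^{\mathbb{N}}:\|x\|_k=\sum_j|x_j|a_{j,k}<\infty\ \forall k\}$; $\lambda^\infty(A)=\{x\in\mathbb{K}^{\mathbb{N}}:\|x\|_k=\sup_j|x_j|a_{j,k}<\infty\ \forall k\}$; $\lambda^\infty_0(A)=\{x\in\lambda^\infty(A):\lim_{j\to\infty}x_ja_{j,k}=0\ \forall k\}$, each graded by the indicated seminorms. $L(E,F)$ is the space of continuous linear operators $E\to F$. For $T\in L(E,F)$ put $\|T\|_{k,r}=\sup_{\|x\|_r\le1}\|Tx\|_k\in[0,\infty]$ and $\pi_T(k)=\inf\{r\in\mathbb{N}:\|T\|_{k,r}<\infty\}$. $L^G(E,F)$ is the set of $T\in L(E,F)$ of the form $T=RQ$ with $Q\in L(E,G)$, $R\in L(G,F)$. $(E,G,F)\in\mathfrak{TF}$ (tame factorization property) means: there is a nondecreasing $S:\mathbb{N}\to\mathbb{N}$ such that for every $T\in L^G(E,F)$ there is $k_0$ with $\pi_T(k)\le S(k)$ for all $k\ge k_0$. Conventions: quantities are computed in $[0,\infty]$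 with $1/0=\infty$ and $0/0=0$; a product of two maxima is $\infty$ as soon as one of the maxima is $\infty$. *)

theory Defs
  imports "HOL-Analysis.Analysis" "HOL-Library.Function_Algebras"
begin

text \<open>
  The index set \<open>{1, 2, 3, \<dots>}\<close> is rendered by the type \<^typ>\<open>nat\<close>, that is, every index (of
  coordinates, of seminorms, of the values of \<open>S\<close> and \<open>\<phi>\<close>) is shifted by one.  Only the order of
  the index set matters, so a range \<open>1 \<le> q \<le> q\<^sub>k\<close> becomes \<open>q \<le> q\<^sub>k\<close>.
\<close>

section \<open>Graded spaces and their continuous linear operators\<close>

text \<open>
  A graded space lives on a carrier inside a type whose addition it inherits; the scalar
  multiplication is part of the structure, so that the same notions serve real and complex scalars.
\<close>

record ('k, 'v) graded_space =
  space_of :: "'v set"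
  scale_of :: "'k \<Rightarrow> 'v \<Rightarrow> 'v"
  seminorm :: "'v \<Rightarrow> nat \<Rightarrow> real"

definition graded_topology :: "('k, 'v::ab_group_add) graded_space \<Rightarrow> 'v topology" where
  "graded_topology E = topology_generated_by
     {{y \<in> space_of E. seminorm E (y - x) k < e} | x k e. x \<in> space_of E \<and> 0 < e}"

text \<open>
  Operators are total functions, of which only the restriction to the carrier of the domain is
  relevant; no value is prescribed outside of it.
\<close>

definition continuous_operators ::
  "('k, 'u::ab_group_add) graded_space \<Rightarrow> ('k, 'v::ab_group_add) graded_space \<Rightarrow> ('u \<Rightarrow> 'v) set"
  where
  "continuous_operators E F = {T.
     T \<in> space_of E \<rightarrow> space_of F \<and>
     (\<forall>x\<in>space_of E. \<forall>y\<in>space_of E. T (x + y) = T x + T y) \<and>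
     (\<forall>c. \<forall>x\<in>space_of E. T (scale_of E c x) = scale_of F c (T x)) \<and>
     continuous_map (graded_topology E) (graded_topology F) T}"

definition operators_through ::
  "('k, 'u::ab_group_add) graded_space \<Rightarrow> ('k, 'w::ab_group_add) graded_space \<Rightarrow>
   ('k, 'v::ab_group_add) graded_space \<Rightarrow> ('u \<Rightarrow> 'v) set"
  where
  "operators_through E G F = {T \<in> continuous_operators E F.
     \<exists>Q\<in>continuous_operators E G. \<exists>R\<in>continuous_operators G F.
       \<forall>x\<in>space_of E. T x = R (Q x)}"

definition operator_seminorm ::
  "('k, 'u) graded_space \<Rightarrow> ('k, 'v) graded_space \<Rightarrow> ('u \<Rightarrow> 'v) \<Rightarrow> nat \<Rightarrow> nat \<Rightarrow> ennreal" where
  "operator_seminorm E F T k r =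
     (SUP x\<in>{x \<in> space_of E. seminorm E x r \<le> 1}. ennreal (seminorm F (T x) k))"

text \<open>The infimum is taken in \<^typ>\<open>enat\<close>, where the infimum of the empty set is \<open>\<infinity>\<close>.\<close>

definition continuity_characteristic ::
  "('k, 'u) graded_space \<Rightarrow> ('k, 'v) graded_space \<Rightarrow> ('u \<Rightarrow> 'v) \<Rightarrow> nat \<Rightarrow> enat" where
  "continuity_characteristic E F T k = Inf {enat r | r. operator_seminorm E F T k r < \<infinity>}"

definition tame_factorization ::
  "('k, 'u::ab_group_add) graded_space \<Rightarrow> ('k, 'w::ab_group_add) graded_space \<Rightarrow>
   ('k, 'v::ab_group_add) graded_space \<Rightarrow> bool"
  where
  "tame_factorization E G F \<longleftrightarrow>
     (\<exists>S::nat \<Rightarrow> nat. mono S \<and>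
       (\<forall>T\<in>operators_through E G F. \<exists>k0. \<forall>k\<ge>k0. continuity_characteristic E F T k \<le> enat (S k)))"

section \<open>Koethe spaces\<close>

definition kothe_matrix :: "(nat \<Rightarrow> nat \<Rightarrow> real) \<Rightarrow> bool" where
  "kothe_matrix A \<longleftrightarrow>
     (\<forall>n k. 0 \<le> A n k) \<and> (\<forall>n k. A n k \<le> A n (Suc k)) \<and> (\<forall>n. \<exists>k. 0 < A n k)"

type_synonym 'k sequence_space = "('k, nat \<Rightarrow> 'k) graded_space"

definition kothe_l1 :: "(nat \<Rightarrow> nat \<Rightarrow> real) \<Rightarrow> 'k::real_normed_field sequence_space" where
  "kothe_l1 A = \<lparr>
     space_of = {x. \<forall>k. summable (\<lambda>j. norm (x j) * A j k)},
     scale_of = (\<lambda>c x j. c * x j),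
     seminorm = (\<lambda>x k. \<Sum>j. norm (x j) * A j k)\<rparr>"

definition kothe_linf :: "(nat \<Rightarrow> nat \<Rightarrow> real) \<Rightarrow> 'k::real_normed_field sequence_space" where
  "kothe_linf A = \<lparr>
     space_of = {x. \<forall>k. bdd_above (range (\<lambda>j. norm (x j) * A j k))},
     scale_of = (\<lambda>c x j. c * x j),
     seminorm = (\<lambda>x k. SUP j. norm (x j) * A j k)\<rparr>"

definition kothe_c0 :: "(nat \<Rightarrow> nat \<Rightarrow> real) \<Rightarrow> 'k::real_normed_field sequence_space" where
  "kothe_c0 A = (kothe_linf A)\<lparr>
     space_of := {x \<in> space_of (kothe_linf A). \<forall>k. (\<lambda>j. x j * of_real (A j k)) \<longlonglongrightarrow> 0}\<rparr>"

datatype kothe_kind = L1 | Linf | C0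

fun kothe_space :: "kothe_kind \<Rightarrow> (nat \<Rightarrow> nat \<Rightarrow> real) \<Rightarrow> 'k::real_normed_field sequence_space" where
  "kothe_space L1 = kothe_l1"
| "kothe_space Linf = kothe_linf"
| "kothe_space C0 = kothe_c0"

section \<open>The condition on the matrices\<close>

text \<open>
  Division in \<^typ>\<open>ennreal\<close> satisfies \<open>t / 0 = \<infinity>\<close> for \<open>t > 0\<close> and \<open>0 / 0 = 0\<close>.  Its multiplication has
  \<open>0 * \<infinity> = 0\<close>, however, whereas the product of the two maxima below is to be \<open>\<infinity>\<close> as soon as one of
  the factors is.
\<close>

definition times_top :: "ennreal \<Rightarrow> ennreal \<Rightarrow> ennreal" where
  "times_top s t = (if s = \<infinity> \<or> t = \<infinity> then \<infinity> else s * t)"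

definition tame_matrix_condition ::
  "(nat \<Rightarrow> nat \<Rightarrow> real) \<Rightarrow> (nat \<Rightarrow> nat \<Rightarrow> real) \<Rightarrow> (nat \<Rightarrow> nat \<Rightarrow> real) \<Rightarrow> bool" where
  "tame_matrix_condition A B C \<longleftrightarrow>
     (\<exists>S::nat \<Rightarrow> nat. mono S \<and>
       (\<forall>\<phi>::nat \<Rightarrow> nat. mono \<phi> \<longrightarrow>
         (\<exists>k0. \<forall>k\<ge>k0. \<exists>qk::nat. \<exists>Ck::real. 0 < Ck \<and>
           (\<forall>i j \<nu>.
             ennreal (C j k) / ennreal (A i (S k)) \<le>
               ennreal Ck *
               times_top
                 (MAX q\<in>{..qk}. ennreal (B \<nu> q) / ennreal (A i (\<phi> q)))
                 (MAX q\<in>{..qk}. ennreal (C j q) / ennreal (B \<nu> (\<phi> q)))))))"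

end

theory Submission imports Defs begin

text \<open>
  Sufficiency.  For fixed \<open>k\<close> the matrix inequality separates, for every \<open>\<nu>\<close>, the index \<open>i\<close> from the
  index \<open>j\<close> by a weight \<open>w \<nu>\<close>, and it remains to show that a matrix which is bounded for finitely many
  pairs of weights \<open>a\<^sub>p\<close>, \<open>b\<^sub>p\<close> is bounded for \<open>s\<close>, \<open>w\<close> as soon as
  \<open>w \<nu> / s i \<le> max\<^sub>p (b \<nu> p / a i p)\<close>.  This is immediate unless the matrix maps \<open>c\<^sub>0\<close> to \<open>\<ell>\<^sup>1\<close>, where
  entrywise estimates do not control the norm.  In general one sorts the indices by the dyadic size of
  \<open>a i p / s i\<close> and \<open>b \<nu> p / w \<nu>\<close>: restricting a matrix to the entries on which two such levels differ
  by a given \<open>k\<close> is a contraction, which averages sign changes, and gains a factor \<open>2\<close> to the power \<open>-k\<close>;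
  inclusion-exclusion over \<open>p\<close> recovers the whole matrix from these pieces with a convergent sum.

  Necessity.  If the inequality fails, a gliding hump produces two series of rank one operators
  between coordinates.  As all coefficients are positive, no cancellation occurs in their product, and
  so the product violates the tame estimate.
\<close>

section \<open>Graded spaces\<close>

text \<open>The \<open>p\<close> that realises the maximum depends on the entry of the matrix, and
  this shapes the sufficiency proof. Keeping only the entries that satisfy a threshold inequality
  between row and column is a triangular truncation, which has no bound independent of the size for
  matrices from c_0 to l^1. Cuts along an equality between a function of the row and a function of
  the column are harmless, so thresholds are rewritten as sums of such equalities, one for each gap
  between dyadic levels, and the gain in the gap makes the sum converge.

  The estimates are made for finite sections with constants independent of their size. The return to
  operators uses density of the finitely supported sequences in the first and in the middle space,
  which is why these are not of kind \<open>Linf\<close>; seminorms of the target are controlled by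
  its finite heads for every kind.

  For necessity a single operator has to fail at some fixed \<open>k\<close> against every constant,
  so each bad \<open>k\<close> must be revisited infinitely often in the construction. The factor 2
  to the power \<open>-n\<close> in the coefficients makes both series converge absolutely for all
  kinds of spaces.\<close>

locale seminormed =
  fixes E :: "('k::real_normed_field, 'v::ab_group_add) graded_space"
  assumes zero_in [simp]: "0 \<in> space_of E"
    and add_in [simp]: "x \<in> space_of E \<Longrightarrow> y \<in> space_of E \<Longrightarrow> x + y \<in> space_of E"
    and diff_in [simp]: "x \<in> space_of E \<Longrightarrow> y \<in> space_of E \<Longrightarrow> x - y \<in> space_of E"
    and scale_in [simp]: "x \<in> space_of E \<Longrightarrow> scale_of E c x \<in> space_of E"
    and seminorm_zero [simp]: "seminorm E 0 k = 0"
    and seminorm_nonneg [simp]: "x \<in> space_of E \<Longrightarrow> 0 \<le> seminorm E x k"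
    and seminorm_triangle:
      "x \<in> space_of E \<Longrightarrow> y \<in> space_of E \<Longrightarrow> seminorm E (x + y) k \<le> seminorm E x k + seminorm E y k"
    and seminorm_scale:
      "x \<in> space_of E \<Longrightarrow> seminorm E (scale_of E c x) k = norm c * seminorm E x k"
    and seminorm_mono: "x \<in> space_of E \<Longrightarrow> k \<le> l \<Longrightarrow> seminorm E x k \<le> seminorm E x l"
begin

definition seminorm_ball :: "'v \<Rightarrow> nat \<Rightarrow> real \<Rightarrow> 'v set" where
  "seminorm_ball x k e = {y \<in> space_of E. seminorm E (y - x) k < e}"

lemma graded_topology_balls:
  "graded_topology E = topology_generated_by {seminorm_ball x k e | x k e. x \<in> space_of E \<and> 0 < e}"
  by (simp add: graded_topology_def seminorm_ball_def)

lemma openin_seminorm_ball: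
  "x \<in> space_of E \<Longrightarrow> 0 < e \<Longrightarrow> openin (graded_topology E) (seminorm_ball x k e)"
  unfolding graded_topology_balls by (rule topology_generated_by_Basis) blast

lemma centre_in_seminorm_ball: "x \<in> space_of E \<Longrightarrow> 0 < e \<Longrightarrow> x \<in> seminorm_ball x k e"
  by (simp add: seminorm_ball_def)

lemma topspace_graded_topology [simp]: "topspace (graded_topology E) = space_of E"
proof
  show "topspace (graded_topology E) \<subseteq> space_of E"
    unfolding graded_topology_balls topology_generated_by_topspace by (auto simp: seminorm_ball_def)
  show "space_of E \<subseteq> topspace (graded_topology E)"
    using openin_seminorm_ball[where e = 1 and k = 0] centre_in_seminorm_ball[where e = 1 and k = 0]
      openin_subset by (metis subsetD subsetI zero_less_one)
qed

text \<open>Balls with arbitrary centres are only given as a subbase. The proof follows the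
  generation of the topology: the triangle inequality recentres a ball at \<open>x\<close>, and the
  grading lets one ball of index \<open>max k l\<close> serve an intersection.\<close>

lemma open_contains_ball:
  assumes "openin (graded_topology E) U" "x \<in> U"
  shows "\<exists>k e. 0 < e \<and> seminorm_ball x k e \<subseteq> U"
proof -
  have "generate_topology_on {seminorm_ball x k e | x k e. x \<in> space_of E \<and> 0 < e} U"
    using assms(1) unfolding graded_topology_balls openin_topology_generated_by_iff .
  then have "\<forall>x\<in>U. \<exists>k e. 0 < e \<and> seminorm_ball x k e \<subseteq> U"
  proof induction
    case Empty
    then show ?case by simp
  next
    case (Int U V)
    show ?case
    proof
      fix x assume x: "x \<in> U \<inter> V"
      obtain k e where ke: "0 < e" "seminorm_ball x k e \<subseteq> U" using Int x by blast
      obtain l d where ld: "0 < d" "seminorm_ball x l d \<subseteq> V" using Int x by blast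
      have x_in: "x \<in> space_of E"
        using x Int(1) openin_subset[of "graded_topology E" U]
        unfolding topspace_graded_topology
        unfolding graded_topology_balls openin_topology_generated_by_iff by blast
      have "seminorm_ball x (max k l) (min e d) \<subseteq> U \<inter> V"
      proof
        fix y assume y: "y \<in> seminorm_ball x (max k l) (min e d)"
        then have "y - x \<in> space_of E" using x_in by (simp add: seminorm_ball_def)
        then have "seminorm E (y - x) k \<le> seminorm E (y - x) (max k l)"
          "seminorm E (y - x) l \<le> seminorm E (y - x) (max k l)"
          by (simp_all add: seminorm_mono)
        then have "y \<in> seminorm_ball x k e" "y \<in> seminorm_ball x l d"
          using y by (simp_all add: seminorm_ball_def)
        then show "y \<in> U \<inter> V" using ke ld by blast
      qed
      then show "\<exists>k e. 0 < e \<and> seminorm_ball x k e \<subseteq> U \<inter> V"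
        using ke ld by (metis min_less_iff_conj)
    qed
  next
    case (UN K)
    then show ?case by (meson UnionE Union_upper subset_trans)
  next
    case (Basis s)
    then obtain z k e where z: "z \<in> space_of E" "0 < e" and s: "s = seminorm_ball z k e" by blast
    show ?case
    proof
      fix x assume "x \<in> s"
      then have x: "x \<in> space_of E" "seminorm E (x - z) k < e" by (simp_all add: s seminorm_ball_def)
      have "seminorm_ball x k (e - seminorm E (x - z) k) \<subseteq> s"
      proof
        fix y assume "y \<in> seminorm_ball x k (e - seminorm E (x - z) k)"
        then have y: "y \<in> space_of E" "seminorm E (y - x) k < e - seminorm E (x - z) k"
          by (simp_all add: seminorm_ball_def)
        have "seminorm E ((y - x) + (x - z)) k \<le> seminorm E (y - x) k + seminorm E (x - z) k"
          using x y z by (intro seminorm_triangle) auto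
        then show "y \<in> s" using y by (simp add: s seminorm_ball_def)
      qed
      then show "\<exists>k e. 0 < e \<and> seminorm_ball x k e \<subseteq> s" using x by (metis diff_gt_0_iff_gt)
    qed
  qed
  then show ?thesis using assms(2) by blast
qed

end

section \<open>Continuity and the characteristic of an operator in terms of seminorm
  estimates\<close>

lemma bounded_on_ball_imp_bounded:
  fixes E :: "('k::real_normed_field, 'u::ab_group_add) graded_space"
    and F :: "('k, 'v::ab_group_add) graded_space"
  assumes "seminormed E" "seminormed F"
    and T: "\<And>x. x \<in> space_of E \<Longrightarrow> T x \<in> space_of F"
      "\<And>c x. x \<in> space_of E \<Longrightarrow> T (scale_of E c x) = scale_of F c (T x)"
    and e: "0 < e"
    and ball: "\<And>x. x \<in> space_of E \<Longrightarrow> seminorm E x r < e \<Longrightarrow> seminorm F (T x) k \<le> M"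
    and x: "x \<in> space_of E"
  shows "seminorm F (T x) k \<le> 2 * M / e * seminorm E x r"
proof -
  interpret E: seminormed E by fact
  interpret F: seminormed F by fact
  have scaled: "norm c * seminorm F (T x) k \<le> M" if "norm c * seminorm E x r < e" for c :: 'k
    using ball[of "scale_of E c x"] that x T by (simp add: E.seminorm_scale F.seminorm_scale)
  show ?thesis
  proof (cases "seminorm E x r = 0")
    case True
    \<comment> \<open>All multiples of \<open>x\<close> lie in the ball, so the images of
      arbitrarily large multiples stay below \<open>M\<close>; this forces the seminorm of
      \<open>T x\<close> to vanish.\<close>
    have "seminorm F (T x) k \<le> 0"
    proof (rule ccontr)
      assume "\<not> ?thesis"
      then obtain n :: nat where "M < real n * seminorm F (T x) k"
        using reals_Archimedean3 by (metis not_le)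
      then show False using scaled[of "of_nat n"] True e by simp
    qed
    then show ?thesis using True by simp
  next
    case False
    then have pos: "0 < seminorm E x r" using E.seminorm_nonneg[OF x] by (metis less_eq_real_def)
    \<comment> \<open>Halving keeps the multiple of \<open>x\<close> strictly inside the open ball;
      this is the 2 of the conclusion.\<close>
    define c where "c = (of_real (e / (2 * seminorm E x r)) :: 'k)"
    have "norm c = e / (2 * seminorm E x r)"
      unfolding c_def using pos e by (subst norm_of_real) simp
    moreover have "norm c * seminorm F (T x) k * (2 * seminorm E x r / e) \<le> M * (2 * seminorm E x r / e)"
      if "norm c * seminorm E x r < e"
      using scaled[OF that] pos e by (intro mult_right_mono) auto
    ultimately show ?thesis using pos e by (simp add: mult_ac)
  qed
qed

lemma continuous_operator_imp_bounded:
  assumes "seminormed E" "seminormed F" and T: "T \<in> continuous_operators E F"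
  shows "\<exists>r D. \<forall>x\<in>space_of E. seminorm F (T x) k \<le> D * seminorm E x r"
proof -
  interpret E: seminormed E by fact
  interpret F: seminormed F by fact
  have into: "T x \<in> space_of F" if "x \<in> space_of E" for x
    using T that by (auto simp: continuous_operators_def)
  have sc: "T (scale_of E c x) = scale_of F c (T x)" if "x \<in> space_of E" for x c
    using T that by (auto simp: continuous_operators_def)
  have "T (0 + 0) = T 0 + T 0"
    using T E.zero_in unfolding continuous_operators_def by blast
  then have T0: "T 0 = 0" by simp
  define U where "U = {x \<in> space_of E. T x \<in> F.seminorm_ball 0 k 1}"
  have "openin (graded_topology E) U"
    using T F.openin_seminorm_ball[of 0 1 k]
    by (auto simp: U_def continuous_operators_def dest!: openin_continuous_map_preimage)
  moreover have "0 \<in> U" by (simp add: U_def T0 F.centre_in_seminorm_ball)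
  ultimately obtain r e where "0 < e" and re: "E.seminorm_ball 0 r e \<subseteq> U"
    using E.open_contains_ball by blast
  then have "seminorm F (T x) k \<le> 1" if "x \<in> space_of E" "seminorm E x r < e" for x
    using that by (auto simp: U_def E.seminorm_ball_def F.seminorm_ball_def subset_iff intro: less_imp_le)
  from bounded_on_ball_imp_bounded[OF assms(1,2) into sc \<open>0 < e\<close> this] show ?thesis by blast
qed

lemma continuous_operators_diff:
  assumes "seminormed E" "T \<in> continuous_operators E F" "x \<in> space_of E" "y \<in> space_of E"
  shows "T (x - y) = T x - T y"
proof -
  interpret E: seminormed E by fact
  have "T ((x - y) + y) = T (x - y) + T y"
    using assms E.diff_in[OF assms(3,4)] unfolding continuous_operators_def by blast
  then show ?thesis by (simp add: algebra_simps)
qed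

lemma continuous_operatorsI:
  assumes "seminormed E" "seminormed F"
    and T: "\<And>x. x \<in> space_of E \<Longrightarrow> T x \<in> space_of F"
      "\<And>x y. x \<in> space_of E \<Longrightarrow> y \<in> space_of E \<Longrightarrow> T (x + y) = T x + T y"
      "\<And>c x. x \<in> space_of E \<Longrightarrow> T (scale_of E c x) = scale_of F c (T x)"
    and bounded: "\<And>k. \<exists>r D. \<forall>x\<in>space_of E. seminorm F (T x) k \<le> D * seminorm E x r"
  shows "T \<in> continuous_operators E F"
proof -
  interpret E: seminormed E by fact
  interpret F: seminormed F by fact
  have diff: "T (x - y) = T x - T y" if "x \<in> space_of E" "y \<in> space_of E" for x y
    using T(2)[of "x - y" y] that by (simp add: algebra_simps)
  have "openin (graded_topology E) (T -` F.seminorm_ball z k e \<inter> space_of E)"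
    if z: "z \<in> space_of F" "0 < e" for z k e
  proof (subst openin_subopen, intro ballI)
    fix x assume x: "x \<in> T -` F.seminorm_ball z k e \<inter> space_of E"
    then have x': "x \<in> space_of E" "T x \<in> space_of F" "seminorm F (T x - z) k < e"
      by (auto simp: F.seminorm_ball_def)
    obtain r D where D: "\<And>y. y \<in> space_of E \<Longrightarrow> seminorm F (T y) k \<le> D * seminorm E y r"
      using bounded by blast
    \<comment> \<open>\<open>\<bar>D\<bar> + 1\<close> is positive whatever the sign of
      \<open>D\<close>, and still bounds the operator.\<close>
    define d where "d = (e - seminorm F (T x - z) k) / (\<bar>D\<bar> + 1)"
    have d: "0 < d" using x' by (simp add: d_def)
    have "E.seminorm_ball x r d \<subseteq> T -` F.seminorm_ball z k e \<inter> space_of E"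
    proof
      fix y assume "y \<in> E.seminorm_ball x r d"
      then have y: "y \<in> space_of E" "seminorm E (y - x) r < d" by (auto simp: E.seminorm_ball_def)
      have "seminorm F (T y - z) k = seminorm F (T (y - x) + (T x - z)) k"
        using diff y x' by simp
      also have "\<dots> \<le> seminorm F (T (y - x)) k + seminorm F (T x - z) k"
        using x' y z T by (intro F.seminorm_triangle) auto
      also have "seminorm F (T (y - x)) k \<le> (\<bar>D\<bar> + 1) * seminorm E (y - x) r"
        using D[of "y - x"] x' y E.seminorm_nonneg[of "y - x" r]
        by (smt (verit) E.diff_in mult_right_mono)
      also have "\<dots> < (\<bar>D\<bar> + 1) * d" using y by (intro mult_strict_left_mono) auto
      also have "\<dots> = e - seminorm F (T x - z) k" by (simp add: d_def)
      finally show "y \<in> T -` F.seminorm_ball z k e \<inter> space_of E"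
        using y T by (simp add: F.seminorm_ball_def)
    qed
    then show "\<exists>V. openin (graded_topology E) V \<and> x \<in> V \<and> V \<subseteq> T -` F.seminorm_ball z k e \<inter> space_of E"
      using E.openin_seminorm_ball[OF x'(1) d] E.centre_in_seminorm_ball[OF x'(1) d]
      by (intro exI[of _ "E.seminorm_ball x r d"] conjI)
  qed
  then have "continuous_map (graded_topology E) (graded_topology F) T"
    unfolding F.graded_topology_balls continuous_on_generated_topo_iff
    using T F.topspace_graded_topology
    by (auto simp: F.graded_topology_balls)
  then show ?thesis using T by (auto simp: continuous_operators_def)
qed

lemma continuous_operators_compose:
  assumes "Q \<in> continuous_operators E G" "R \<in> continuous_operators G F"
  shows "R \<circ> Q \<in> continuous_operators E F"
proof -
  have "continuous_map (graded_topology E) (graded_topology F) (R \<circ> Q)"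
    using assms unfolding continuous_operators_def by (auto intro: continuous_map_compose)
  then show ?thesis using assms unfolding continuous_operators_def by (auto simp: Pi_iff)
qed

text \<open>An infimum of extended naturals below a finite bound is attained, so some
  \<open>r' \<le> r\<close> has a finite operator seminorm, and homogeneity turns the bound on the
  unit ball into an estimate. Through this equivalence tameness becomes a plain inequality between
  seminorms.\<close>

lemma continuity_characteristic_le_iff:
  assumes "seminormed E" "seminormed F"
    and T: "\<And>x. x \<in> space_of E \<Longrightarrow> T x \<in> space_of F"
      "\<And>c x. x \<in> space_of E \<Longrightarrow> T (scale_of E c x) = scale_of F c (T x)"
  shows "continuity_characteristic E F T k \<le> enat r \<longleftrightarrow>
    (\<exists>D. \<forall>x\<in>space_of E. seminorm F (T x) k \<le> D * seminorm E x r)"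
proof
  interpret E: seminormed E by fact
  interpret F: seminormed F by fact
  {
    assume le: "continuity_characteristic E F T k \<le> enat r"
    define X where "X = {enat r | r. operator_seminorm E F T k r < \<infinity>}"
    have "X \<noteq> {}"
      using le unfolding continuity_characteristic_def X_def[symmetric] by (auto simp: Inf_enat_def)
    then have "Inf X \<in> X" by (simp add: Inf_enat_def) (meson LeastI_ex ex_in_conv)
    then obtain r' where r': "operator_seminorm E F T k r' < \<infinity>" "r' \<le> r"
      using le unfolding continuity_characteristic_def X_def[symmetric] by (auto simp: X_def)
    define M where "M = enn2real (operator_seminorm E F T k r')"
    have "seminorm F (T x) k \<le> M" if x: "x \<in> space_of E" "seminorm E x r < 1" for x
    proof -
      have "seminorm E x r' \<le> 1" using E.seminorm_mono[OF x(1) r'(2)] x by simp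
      then have "ennreal (seminorm F (T x) k) \<le> operator_seminorm E F T k r'"
        unfolding operator_seminorm_def using x by (intro SUP_upper) auto
      also have "\<dots> = ennreal M" using r' by (simp add: M_def)
      finally show ?thesis by (simp add: M_def)
    qed
    from bounded_on_ball_imp_bounded[OF assms(1,2) T zero_less_one this]
    show "\<exists>D. \<forall>x\<in>space_of E. seminorm F (T x) k \<le> D * seminorm E x r" by blast
  }
  {
    assume "\<exists>D. \<forall>x\<in>space_of E. seminorm F (T x) k \<le> D * seminorm E x r"
    then obtain D where D: "\<And>x. x \<in> space_of E \<Longrightarrow> seminorm F (T x) k \<le> D * seminorm E x r" by blast
    have "operator_seminorm E F T k r \<le> ennreal \<bar>D\<bar>"
      unfolding operator_seminorm_def
    proof (rule SUP_least, rule ennreal_leI)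
      fix x assume "x \<in> {x \<in> space_of E. seminorm E x r \<le> 1}"
      then have x: "x \<in> space_of E" "seminorm E x r \<le> 1" by auto
      have "seminorm F (T x) k \<le> \<bar>D\<bar> * seminorm E x r"
        using D[OF x(1)] E.seminorm_nonneg[OF x(1), of r]
        by (smt (verit) mult_right_mono)
      then show "seminorm F (T x) k \<le> \<bar>D\<bar>"
        using x mult_left_le[OF x(2), of "\<bar>D\<bar>"] by simp
    qed
    then have "operator_seminorm E F T k r < \<infinity>" by (simp add: le_less_trans)
    then show "continuity_characteristic E F T k \<le> enat r"
      unfolding continuity_characteristic_def by (intro Inf_lower) blast
  }
qed

section \<open>Koethe spaces\<close>

text \<open>The argument \<open>g\<close> is the sequence of weighted absolute values; the inserted \<open>0\<close> covers \<open>n = 0\<close>.\<close>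

definition head_norm :: "kothe_kind \<Rightarrow> nat \<Rightarrow> (nat \<Rightarrow> real) \<Rightarrow> real" where
  "head_norm m n g = (if m = L1 then \<Sum>i<n. g i else Max (insert 0 (g ` {..<n})))"

lemma head_norm_le_iff: "m \<noteq> L1 \<Longrightarrow> head_norm m n g \<le> M \<longleftrightarrow> 0 \<le> M \<and> (\<forall>i<n. g i \<le> M)"
  by (auto simp: head_norm_def)

lemma head_norm_mono: "(\<And>i. i < n \<Longrightarrow> g i \<le> h i) \<Longrightarrow> head_norm m n g \<le> head_norm m n h"
proof (cases "m = L1")
  case False
  assume "\<And>i. i < n \<Longrightarrow> g i \<le> h i"
  moreover have "0 \<le> head_norm m n h \<and> (\<forall>i<n. h i \<le> head_norm m n h)"
    using False head_norm_le_iff by blast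
  ultimately show ?thesis using False by (subst head_norm_le_iff) (auto intro: order_trans)
qed (auto simp: head_norm_def intro: sum_mono)

lemma head_norm_cong: "(\<And>i. i < n \<Longrightarrow> g i = h i) \<Longrightarrow> head_norm m n g = head_norm m n h"
  by (intro antisym head_norm_mono) auto

lemma head_norm_zero [simp]: "head_norm m n (\<lambda>_. 0) = 0"
proof (cases "m = L1")
  case False
  then have "head_norm m n (\<lambda>_. 0) \<le> 0" by (simp add: head_norm_le_iff)
  moreover have "0 \<le> head_norm m n (\<lambda>_. 0)" using False head_norm_le_iff by blast
  ultimately show ?thesis by simp
qed (simp add: head_norm_def)

lemma head_norm_nonneg: "(\<And>i. i < n \<Longrightarrow> 0 \<le> g i) \<Longrightarrow> 0 \<le> head_norm m n g"
  using head_norm_mono[of n "\<lambda>_. 0" g m] by simp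

lemma head_norm_add: "head_norm m n (\<lambda>i. g i + h i) \<le> head_norm m n g + head_norm m n h"
proof (cases "m = L1")
  case False
  have "0 \<le> head_norm m n f \<and> (\<forall>i<n. f i \<le> head_norm m n f)" for f
    using False head_norm_le_iff by blast
  then show ?thesis using False by (subst head_norm_le_iff) (auto intro: add_mono)
qed (simp add: head_norm_def sum.distrib)

lemma head_norm_scale: "0 \<le> c \<Longrightarrow> head_norm m n (\<lambda>i. c * g i) = c * head_norm m n g"
proof (cases "m = L1")
  case False
  assume "0 \<le> c"
  then have le: "head_norm m n (\<lambda>i. c * f i) \<le> c * head_norm m n f" if "0 \<le> c" for f c
    using False that head_norm_le_iff[of m n f "head_norm m n f"]
    by (subst head_norm_le_iff) (auto intro: mult_left_mono)
  show ?thesis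
  proof (cases "c = 0")
    case False
    then have "head_norm m n g \<le> inverse c * head_norm m n (\<lambda>i. c * g i)"
      using le[of "inverse c" "\<lambda>i. c * g i"] \<open>0 \<le> c\<close> by (simp add: mult.assoc[symmetric])
    then have "c * head_norm m n g \<le> head_norm m n (\<lambda>i. c * g i)"
      using False \<open>0 \<le> c\<close> by (simp add: field_simps)
    then show ?thesis using le[OF \<open>0 \<le> c\<close>] by (simp add: antisym)
  qed simp
qed (simp add: head_norm_def sum_distrib_left)

lemma le_head_norm: "i < n \<Longrightarrow> (\<And>j. j < n \<Longrightarrow> 0 \<le> g j) \<Longrightarrow> g i \<le> head_norm m n g"
  by (cases "m = L1") (auto simp: head_norm_def intro: member_le_sum)

lemma head_norm_single:
  assumes "i < n" "0 \<le> c"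
  shows "head_norm m n (\<lambda>j. if j = i then c else 0) = c"
proof (cases "m = L1")
  case False
  then have "head_norm m n (\<lambda>j. if j = i then c else 0) \<le> c" using assms by (simp add: head_norm_le_iff)
  moreover have "c \<le> head_norm m n (\<lambda>j. if j = i then c else 0)"
    using le_head_norm[of i n "\<lambda>j. if j = i then c else 0" m] assms by simp
  ultimately show ?thesis by simp
qed (use assms in \<open>simp add: head_norm_def\<close>)

abbreviation kothe_head_norm ::
  "kothe_kind \<Rightarrow> (nat \<Rightarrow> nat \<Rightarrow> real) \<Rightarrow> nat \<Rightarrow> nat \<Rightarrow> (nat \<Rightarrow> 'k::real_normed_field) \<Rightarrow> real" where
  "kothe_head_norm m A n k x \<equiv> head_norm m n (\<lambda>i. norm (x i) * A i k)"

definition head_seq :: "nat \<Rightarrow> (nat \<Rightarrow> 'k::zero) \<Rightarrow> nat \<Rightarrow> 'k" where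
  "head_seq n x = (\<lambda>i. if i < n then x i else 0)"

section \<open>The three kinds of spaces, treated together through their finite heads\<close>

lemma kothe_matrix_nonneg: "kothe_matrix A \<Longrightarrow> 0 \<le> A i k"
  by (simp add: kothe_matrix_def)

lemma kothe_matrix_mono: "kothe_matrix A \<Longrightarrow> k \<le> l \<Longrightarrow> A i k \<le> A i l"
  by (simp add: kothe_matrix_def lift_Suc_mono_le)

lemma kothe_matrix_pos: "kothe_matrix A \<Longrightarrow> \<exists>k. 0 < A i k"
  by (simp add: kothe_matrix_def)

lemma scale_of_kothe_space [simp]: "scale_of (kothe_space m A) = (\<lambda>c x j. c * x j)"
  by (cases m) (simp_all add: kothe_l1_def kothe_linf_def kothe_c0_def)

text \<open>Infinite sums and suprema are traded for uniform bounds on finite heads, so that the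
  kinds can share one argument; only \<open>C0\<close> keeps a condition of its own.\<close>

lemma kothe_space_iff:
  assumes A: "kothe_matrix A"
  shows "x \<in> space_of (kothe_space m A) \<longleftrightarrow>
    (\<forall>k. \<exists>M. \<forall>n. kothe_head_norm m A n k x \<le> M) \<and>
    (m = C0 \<longrightarrow> (\<forall>k. (\<lambda>j. norm (x j) * A j k) \<longlonglongrightarrow> 0))"
proof -
  have nonneg: "0 \<le> norm (x j) * A j k" for j k using A by (simp add: kothe_matrix_nonneg)
  have l1: "summable (\<lambda>j. norm (x j) * A j k) \<longleftrightarrow> (\<exists>M. \<forall>n. kothe_head_norm L1 A n k x \<le> M)" for k
  proof
    assume "summable (\<lambda>j. norm (x j) * A j k)"
    then show "\<exists>M. \<forall>n. kothe_head_norm L1 A n k x \<le> M"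
      using nonneg sum_le_suminf[of "\<lambda>j. norm (x j) * A j k"]
      by (auto simp: head_norm_def intro!: exI[of _ "\<Sum>j. norm (x j) * A j k"])
  next
    assume "\<exists>M. \<forall>n. kothe_head_norm L1 A n k x \<le> M"
    then show "summable (\<lambda>j. norm (x j) * A j k)"
      using nonneg by (auto simp: head_norm_def intro: summableI_nonneg_bounded)
  qed
  have linf: "bdd_above (range (\<lambda>j. norm (x j) * A j k)) \<longleftrightarrow> (\<exists>M. \<forall>n. kothe_head_norm m A n k x \<le> M)"
    if "m \<noteq> L1" for k
  proof
    assume "bdd_above (range (\<lambda>j. norm (x j) * A j k))"
    then obtain M where M: "\<And>j. norm (x j) * A j k \<le> M" by (auto simp: bdd_above_def)
    then have "0 \<le> M" using nonneg order_trans by blast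
    then show "\<exists>M. \<forall>n. kothe_head_norm m A n k x \<le> M" using M that by (auto simp: head_norm_le_iff)
  next
    assume "\<exists>M. \<forall>n. kothe_head_norm m A n k x \<le> M"
    then show "bdd_above (range (\<lambda>j. norm (x j) * A j k))"
      using that by (auto simp: head_norm_le_iff bdd_above_def)
  qed
  have c0: "(\<lambda>j. x j * of_real (A j k)) \<longlonglongrightarrow> 0 \<longleftrightarrow> (\<lambda>j. norm (x j) * A j k) \<longlonglongrightarrow> 0" for k
    using tendsto_norm_zero_iff[of "\<lambda>j. x j * of_real (A j k)" sequentially] A
    by (simp add: norm_mult kothe_matrix_nonneg)
  show ?thesis
    by (cases m) (simp_all add: kothe_l1_def kothe_linf_def kothe_c0_def l1 linf c0)
qed

lemma kothe_head_norm_le_seminorm: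
  assumes A: "kothe_matrix A" and x: "x \<in> space_of (kothe_space m A)"
  shows "kothe_head_norm m A n k x \<le> seminorm (kothe_space m A) x k"
proof -
  have nonneg: "0 \<le> norm (x j) * A j k" for j using A by (simp add: kothe_matrix_nonneg)
  show ?thesis
  proof (cases "m = L1")
    case True
    then show ?thesis using x nonneg by (auto simp: kothe_l1_def head_norm_def intro: sum_le_suminf)
  next
    case False
    then have bdd: "bdd_above (range (\<lambda>j. norm (x j) * A j k))"
      and eq: "seminorm (kothe_space m A) x k = (SUP j. norm (x j) * A j k)"
      using x by (cases m; simp add: kothe_linf_def kothe_c0_def)+
    have "norm (x j) * A j k \<le> (SUP j. norm (x j) * A j k)" for j
      using bdd by (intro cSUP_upper) auto
    moreover from this[of 0] have "0 \<le> (SUP j. norm (x j) * A j k)" using nonneg[of 0] by linarith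
    ultimately show ?thesis using False by (simp add: eq head_norm_le_iff)
  qed
qed

lemma seminorm_le_if_kothe_head_norm_le:
  assumes A: "kothe_matrix A" and x: "x \<in> space_of (kothe_space m A)"
    and M: "\<And>n. kothe_head_norm m A n k x \<le> M"
  shows "seminorm (kothe_space m A) x k \<le> M"
proof (cases "m = L1")
  case True
  then show ?thesis using x M by (auto simp: kothe_l1_def head_norm_def intro: suminf_le_const)
next
  case False
  then have "norm (x j) * A j k \<le> M" for j
    using M[of "Suc j"] by (simp add: head_norm_le_iff)
  then show ?thesis using False by (cases m) (auto simp: kothe_linf_def kothe_c0_def intro: cSUP_least)
qed

lemma coordinate_le_seminorm:
  assumes A: "kothe_matrix A" and x: "x \<in> space_of (kothe_space m A)"
  shows "norm (x i) * A i k \<le> seminorm (kothe_space m A) x k"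
proof -
  have "norm (x i) * A i k \<le> kothe_head_norm m A (Suc i) k x"
    by (intro le_head_norm[of i "Suc i" "\<lambda>i. norm (x i) * A i k"]) (simp_all add: A kothe_matrix_nonneg)
  then show ?thesis using kothe_head_norm_le_seminorm[OF A x] by (rule order_trans)
qed

lemma kothe_space_dominated:
  fixes x z :: "nat \<Rightarrow> 'k::real_normed_field"
  assumes A: "kothe_matrix A" and x: "x \<in> space_of (kothe_space m A :: 'k sequence_space)" and c: "0 \<le> c"
    and z: "\<And>i. norm (z i) \<le> c * norm (x i)"
  shows "z \<in> space_of (kothe_space m A)"
proof -
  have le: "norm (z i) * A i k \<le> c * (norm (x i) * A i k)" for i k
    using mult_right_mono[OF z[of i] kothe_matrix_nonneg[OF A, of i k]] by (simp add: mult.assoc)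
  have "kothe_head_norm m A n k z \<le> c * kothe_head_norm m A n k x" for n k
    using head_norm_mono[of n "\<lambda>i. norm (z i) * A i k" "\<lambda>i. c * (norm (x i) * A i k)" m] le
    by (simp add: head_norm_scale[OF c])
  then have bdd: "\<exists>M. \<forall>n. kothe_head_norm m A n k z \<le> M" for k
    using x c unfolding kothe_space_iff[OF A] by (meson mult_left_mono order_trans)
  have "(\<lambda>i. norm (z i) * A i k) \<longlonglongrightarrow> 0" if "m = C0" for k
  proof (rule tendsto_sandwich[of "\<lambda>_. 0"])
    show "(\<lambda>i. c * (norm (x i) * A i k)) \<longlonglongrightarrow> 0"
      using x that unfolding kothe_space_iff[OF A] by (auto intro: tendsto_mult_right_zero)
  qed (use le A in \<open>auto simp: kothe_matrix_nonneg\<close>)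
  with bdd show ?thesis unfolding kothe_space_iff[OF A] by blast
qed

lemma kothe_space_add:
  fixes x y :: "nat \<Rightarrow> 'k::real_normed_field"
  assumes A: "kothe_matrix A" and x: "x \<in> space_of (kothe_space m A :: 'k sequence_space)"
    and y: "y \<in> space_of (kothe_space m A :: 'k sequence_space)"
  shows "x + y \<in> space_of (kothe_space m A)"
    and "seminorm (kothe_space m A) (x + y) k
      \<le> seminorm (kothe_space m A) x k + seminorm (kothe_space m A) y k"
proof -
  have le: "norm ((x + y) i) * A i k \<le> norm (x i) * A i k + norm (y i) * A i k" for i k
    using mult_right_mono[OF norm_triangle_ineq[of "x i" "y i"] kothe_matrix_nonneg[OF A, of i k]]
    by (simp add: distrib_right)
  have head_norm: "kothe_head_norm m A n k (x + y) \<le> kothe_head_norm m A n k x + kothe_head_norm m A n k y" for n k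
    by (rule order_trans[OF head_norm_mono head_norm_add]) (rule le)
  also have "\<dots> n k \<le> seminorm (kothe_space m A) x k + seminorm (kothe_space m A) y k" for n k
    using assms by (intro add_mono kothe_head_norm_le_seminorm)
  finally have bound: "kothe_head_norm m A n k (x + y)
    \<le> seminorm (kothe_space m A) x k + seminorm (kothe_space m A) y k" for n k .
  have "(\<lambda>i. norm ((x + y) i) * A i k) \<longlonglongrightarrow> 0" if "m = C0" for k
  proof (rule tendsto_sandwich[of "\<lambda>_. 0"])
    show "(\<lambda>i. norm (x i) * A i k + norm (y i) * A i k) \<longlonglongrightarrow> 0"
      using x y that unfolding kothe_space_iff[OF A] by (auto intro: tendsto_add_zero)
  qed (use le A in \<open>auto simp: kothe_matrix_nonneg\<close>)
  then show in_space: "x + y \<in> space_of (kothe_space m A)"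
    unfolding kothe_space_iff[OF A] using bound by blast
  show "seminorm (kothe_space m A) (x + y) k
      \<le> seminorm (kothe_space m A) x k + seminorm (kothe_space m A) y k"
    using bound by (intro seminorm_le_if_kothe_head_norm_le[OF A in_space])
qed

lemma kothe_seminorm_scale_le:
  fixes x :: "nat \<Rightarrow> 'k::real_normed_field"
  assumes A: "kothe_matrix A" and x: "x \<in> space_of (kothe_space m A :: 'k sequence_space)"
  shows "(\<lambda>i. c * x i) \<in> space_of (kothe_space m A)"
    and "seminorm (kothe_space m A) (\<lambda>i. c * x i) k \<le> norm c * seminorm (kothe_space m A) x k"
proof -
  show in_space: "(\<lambda>i. c * x i) \<in> space_of (kothe_space m A)"
    by (rule kothe_space_dominated[OF A x, of "norm c"]) (simp_all add: norm_mult)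
  have "kothe_head_norm m A n k (\<lambda>i. c * x i) = norm c * kothe_head_norm m A n k x" for n
    using head_norm_scale[of "norm c" m n] by (simp add: norm_mult mult.assoc)
  then show "seminorm (kothe_space m A) (\<lambda>i. c * x i) k \<le> norm c * seminorm (kothe_space m A) x k"
    by (intro seminorm_le_if_kothe_head_norm_le[OF A in_space])
      (simp add: mult_left_mono kothe_head_norm_le_seminorm[OF A x])
qed

lemma kothe_space_seminormed:
  assumes A: "kothe_matrix A"
  shows "seminormed (kothe_space m A :: 'k::real_normed_field sequence_space)"
proof
  let ?E = "kothe_space m A :: 'k sequence_space"
  show zero: "0 \<in> space_of ?E" unfolding kothe_space_iff[OF A] by auto
  fix x y :: "nat \<Rightarrow> 'k" and c :: 'k and k l :: nat
  assume x: "x \<in> space_of ?E"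
  have nonneg: "0 \<le> seminorm ?E y k" if "y \<in> space_of ?E" for y k
    by (rule order_trans[OF head_norm_nonneg kothe_head_norm_le_seminorm[OF A that, of 0]]) simp
  then show "0 \<le> seminorm ?E x k" by (simp add: x)
  show "scale_of ?E c x \<in> space_of ?E" using kothe_seminorm_scale_le[OF A x] by simp
  have "norm c * seminorm ?E x k \<le> seminorm ?E (scale_of ?E c x) k"
  proof (cases "c = 0")
    case False
    have "seminorm ?E (\<lambda>i. inverse c * (c * x i)) k \<le> norm (inverse c) * seminorm ?E (\<lambda>i. c * x i) k"
      by (intro kothe_seminorm_scale_le[OF A] kothe_seminorm_scale_le(1)[OF A x])
    moreover have "(\<lambda>i. inverse c * (c * x i)) = x" using False by (simp add: fun_eq_iff)
    ultimately show ?thesis using False by (simp add: norm_inverse norm_divide field_simps)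
  qed (use nonneg[OF kothe_seminorm_scale_le(1)[OF A x, of c]] in simp)
  then show "seminorm ?E (scale_of ?E c x) k = norm c * seminorm ?E x k"
    using kothe_seminorm_scale_le(2)[OF A x] by (simp add: antisym)
  show "seminorm ?E x k \<le> seminorm ?E x l" if "k \<le> l"
  proof (rule seminorm_le_if_kothe_head_norm_le[OF A x])
    fix n
    have "kothe_head_norm m A n k x \<le> kothe_head_norm m A n l x"
      by (intro head_norm_mono mult_left_mono kothe_matrix_mono[OF A that]) simp
    then show "kothe_head_norm m A n k x \<le> seminorm ?E x l"
      using kothe_head_norm_le_seminorm[OF A x] by (rule order_trans)
  qed
  assume y: "y \<in> space_of ?E"
  show "x + y \<in> space_of ?E" "seminorm ?E (x + y) k \<le> seminorm ?E x k + seminorm ?E y k"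
    using kothe_space_add[OF A x y] by auto
  have "x - y = x + (\<lambda>i. (-1) * y i)" by (simp add: fun_eq_iff)
  then show "x - y \<in> space_of ?E"
    using kothe_space_add(1)[OF A x kothe_seminorm_scale_le(1)[OF A y]] by metis
next
  fix k
  let ?E = "kothe_space m A :: 'k sequence_space"
  have zero: "0 \<in> space_of ?E" unfolding kothe_space_iff[OF A] by auto
  have "seminorm ?E 0 k \<le> 0" by (rule seminorm_le_if_kothe_head_norm_le[OF A zero]) simp
  then show "seminorm ?E 0 k = 0"
    using coordinate_le_seminorm[OF A zero, of 0 k] by simp
qed

lemma head_seq_in_kothe_space:
  assumes A: "kothe_matrix A"
  shows "head_seq n x \<in> space_of (kothe_space m A)"
proof -
  define M where "M k = (\<Sum>i<n. norm (x i) * A i k)" for k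
  have nonneg: "0 \<le> norm (x j) * A j k" for j k using A by (simp add: kothe_matrix_nonneg)
  have l1: "kothe_head_norm L1 A N k (head_seq n x) \<le> M k" for N k
  proof -
    have "(\<Sum>i<N. norm (head_seq n x i) * A i k) = (\<Sum>i\<in>{..<N} \<inter> {..<n}. norm (x i) * A i k)"
      by (intro sum.mono_neutral_cong_right) (auto simp: head_seq_def)
    also have "\<dots> \<le> M k" unfolding M_def using nonneg by (intro sum_mono2) auto
    finally show ?thesis by (simp add: head_norm_def)
  qed
  have "kothe_head_norm m A N k (head_seq n x) \<le> M k" for N k
  proof (cases "m = L1")
    case False
    have "0 \<le> M k" unfolding M_def using nonneg by (intro sum_nonneg) auto
    moreover have "norm (head_seq n x i) * A i k \<le> M k" for i
    proof -
      have "norm (head_seq n x i) * A i k \<le> kothe_head_norm L1 A (Suc i) k (head_seq n x)"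
        by (intro le_head_norm[of i "Suc i" "\<lambda>i. norm (head_seq n x i) * A i k"]) (simp_all add: A kothe_matrix_nonneg)
      then show ?thesis using l1 by (rule order_trans)
    qed
    ultimately show ?thesis using False by (simp add: head_norm_le_iff)
  qed (use l1 in simp)
  moreover have "(\<lambda>j. norm (head_seq n x j) * A j k) \<longlonglongrightarrow> 0" for k
    by (intro tendsto_eventually eventually_sequentiallyI[of n]) (simp add: head_seq_def)
  ultimately show ?thesis unfolding kothe_space_iff[OF A] by blast
qed

lemma seminorm_head_seq:
  fixes x :: "nat \<Rightarrow> 'k::real_normed_field"
  assumes A: "kothe_matrix A"
  shows "seminorm (kothe_space m A) (head_seq n x) k = kothe_head_norm m A n k x"
proof (rule antisym)
  have nonneg: "0 \<le> norm (x j) * A j k" for j k using A by (simp add: kothe_matrix_nonneg)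
  show "seminorm (kothe_space m A) (head_seq n x) k \<le> kothe_head_norm m A n k x"
  proof (rule seminorm_le_if_kothe_head_norm_le[OF A head_seq_in_kothe_space[OF A]])
    fix N
    show "kothe_head_norm m A N k (head_seq n x) \<le> kothe_head_norm m A n k x"
    proof (cases "m = L1")
      case True
      have "(\<Sum>i<N. norm (head_seq n x i) * A i k) = (\<Sum>i\<in>{..<N} \<inter> {..<n}. norm (x i) * A i k)"
        by (intro sum.mono_neutral_cong_right) (auto simp: head_seq_def)
      also have "\<dots> \<le> (\<Sum>i<n. norm (x i) * A i k)" using nonneg by (intro sum_mono2) auto
      finally show ?thesis using True by (simp add: head_norm_def)
    next
      case False
      have g0: "0 \<le> kothe_head_norm m A n k x" using nonneg by (intro head_norm_nonneg)
      have "norm (x i) * A i k \<le> kothe_head_norm m A n k x" if "i < n" for i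
        using that nonneg by (intro le_head_norm[of i n "\<lambda>i. norm (x i) * A i k"])
      then show ?thesis using False g0 head_norm_le_iff[of m N] by (auto simp: head_seq_def)
    qed
  qed
  have "kothe_head_norm m A n k x = kothe_head_norm m A n k (head_seq n x)"
    by (rule head_norm_cong) (simp add: head_seq_def)
  also have "\<dots> \<le> seminorm (kothe_space m A) (head_seq n x) k"
    by (rule kothe_head_norm_le_seminorm[OF A head_seq_in_kothe_space[OF A]])
  finally show "kothe_head_norm m A n k x \<le> seminorm (kothe_space m A) (head_seq n x) k" .
qed

text \<open>Density of the finitely supported sequences, with truncations as approximants. It fails
  for \<open>Linf\<close>: a constant sequence over a constant matrix is not approximated.\<close>

lemma seminorm_tail_tendsto:
  fixes x :: "nat \<Rightarrow> 'k::real_normed_field"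
  assumes A: "kothe_matrix A" and x: "x \<in> space_of (kothe_space m A)" and m: "m \<noteq> Linf"
  shows "(\<lambda>n. seminorm (kothe_space m A) (x - head_seq n x) k) \<longlonglongrightarrow> 0"
proof (rule LIMSEQ_I)
  fix e :: real assume e: "0 < e"
  interpret seminormed "kothe_space m A :: 'k sequence_space" by (rule kothe_space_seminormed[OF A])
  let ?g = "\<lambda>i. norm (x i) * A i k"
  have nonneg: "0 \<le> ?g j" for j using A by (simp add: kothe_matrix_nonneg)
  have in_space: "x - head_seq n x \<in> space_of (kothe_space m A)" for n
    by (intro diff_in x head_seq_in_kothe_space[OF A])
  have coord: "norm ((x - head_seq n x) i) * A i k = (if i < n then 0 else ?g i)" for n i
    by (simp add: head_seq_def)
  have "\<exists>n0. \<forall>n\<ge>n0. \<forall>N. kothe_head_norm m A N k (x - head_seq n x) \<le> e / 2"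
  proof (cases "m = L1")
    case True
    then have "summable ?g" using x by (simp add: kothe_l1_def)
    then obtain n0 where n0: "\<And>n N. n0 \<le> n \<Longrightarrow> norm (\<Sum>i=n..<N. ?g i) < e / 2"
      using e summable_Cauchy[of ?g] by (metis half_gt_zero)
    have "kothe_head_norm m A N k (x - head_seq n x) \<le> e / 2" if "n0 \<le> n" for n N
    proof -
      have "kothe_head_norm m A N k (x - head_seq n x) = (\<Sum>i=n..<N. ?g i)"
        unfolding coord using True
        by (simp add: head_norm_def) (intro sum.mono_neutral_cong_right; auto)
      then show ?thesis using n0[OF that, of N] by simp
    qed
    then show ?thesis by blast
  next
    case False
    then have "?g \<longlonglongrightarrow> 0" using m x kothe_space_iff[OF A] by (metis kothe_kind.exhaust)
    then obtain n0 where n0: "\<And>i. n0 \<le> i \<Longrightarrow> ?g i < e / 2"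
      using LIMSEQ_D[of ?g 0 "e / 2"] e nonneg by force
    then have "kothe_head_norm m A N k (x - head_seq n x) \<le> e / 2" if "n0 \<le> n" for n N
      unfolding coord using False e that
      by (subst head_norm_le_iff) (auto intro: less_imp_le)
    then show ?thesis by blast
  qed
  then obtain n0 where "\<And>n. n0 \<le> n \<Longrightarrow> seminorm (kothe_space m A) (x - head_seq n x) k \<le> e / 2"
    using seminorm_le_if_kothe_head_norm_le[OF A in_space] by blast
  then have "norm (seminorm (kothe_space m A) (x - head_seq n x) k - 0) < e" if "n0 \<le> n" for n
    using that e in_space by (smt (verit) field_sum_of_halves real_norm_def seminorm_nonneg)
  then show "\<exists>n0. \<forall>n\<ge>n0. norm (seminorm (kothe_space m A) (x - head_seq n x) k - 0) < e" by blast
qed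

section \<open>Interpolation of matrix bounds\<close>

text \<open>A norm bound for an \<open>n\<close> by \<open>n'\<close> section as an operator between
  weighted finite-dimensional spaces; the first index of \<open>t\<close> belongs to the source.
  Weights may vanish.\<close>

definition matrix_bound ::
  "kothe_kind \<Rightarrow> nat \<Rightarrow> (nat \<Rightarrow> real) \<Rightarrow> kothe_kind \<Rightarrow> nat \<Rightarrow> (nat \<Rightarrow> real) \<Rightarrow>
   (nat \<Rightarrow> nat \<Rightarrow> 'k::real_normed_field) \<Rightarrow> real \<Rightarrow> bool" where
  "matrix_bound m n v m' n' w t D \<longleftrightarrow>
     (\<forall>x. head_norm m' n' (\<lambda>\<nu>. norm (\<Sum>i<n. t i \<nu> * x i) * w \<nu>) \<le> D * head_norm m n (\<lambda>i. norm (x i) * v i))"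

lemma matrix_boundD:
  "matrix_bound m n v m' n' w t D \<Longrightarrow>
    head_norm m' n' (\<lambda>\<nu>. norm (\<Sum>i<n. t i \<nu> * x i) * w \<nu>) \<le> D * head_norm m n (\<lambda>i. norm (x i) * v i)"
  by (simp add: matrix_bound_def)

lemma matrix_bound_cong:
  assumes "matrix_bound m n v m' n' w t D"
    and "\<And>i \<nu>. i < n \<Longrightarrow> \<nu> < n' \<Longrightarrow> w \<nu> \<noteq> 0 \<Longrightarrow> t i \<nu> = u i \<nu>"
  shows "matrix_bound m n v m' n' w u D"
proof -
  have "head_norm m' n' (\<lambda>\<nu>. norm (\<Sum>i<n. t i \<nu> * x i) * w \<nu>)
      = head_norm m' n' (\<lambda>\<nu>. norm (\<Sum>i<n. u i \<nu> * x i) * w \<nu>)" for x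
    using assms(2) by (intro head_norm_cong) (auto intro!: arg_cong[of _ _ norm] sum.cong)
  then show ?thesis using assms(1) by (simp add: matrix_bound_def)
qed

lemma matrix_bound_add:
  assumes "matrix_bound m n v m' n' w t D" "matrix_bound m n v m' n' w u D'" and w: "\<And>\<nu>. 0 \<le> w \<nu>"
  shows "matrix_bound m n v m' n' w (\<lambda>i \<nu>. t i \<nu> + u i \<nu>) (D + D')"
  unfolding matrix_bound_def
proof
  fix x
  have "norm (\<Sum>i<n. (t i \<nu> + u i \<nu>) * x i) * w \<nu>
      \<le> norm (\<Sum>i<n. t i \<nu> * x i) * w \<nu> + norm (\<Sum>i<n. u i \<nu> * x i) * w \<nu>" for \<nu>
    using mult_right_mono[OF norm_triangle_ineq w]
    by (simp add: distrib_right sum.distrib)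
  then have "head_norm m' n' (\<lambda>\<nu>. norm (\<Sum>i<n. (t i \<nu> + u i \<nu>) * x i) * w \<nu>)
    \<le> head_norm m' n' (\<lambda>\<nu>. norm (\<Sum>i<n. t i \<nu> * x i) * w \<nu>)
     + head_norm m' n' (\<lambda>\<nu>. norm (\<Sum>i<n. u i \<nu> * x i) * w \<nu>)"
    by (intro order_trans[OF head_norm_mono head_norm_add])
  also have "\<dots> \<le> (D + D') * head_norm m n (\<lambda>i. norm (x i) * v i)"
    using add_mono[OF assms(1,2)[THEN matrix_boundD]] by (simp add: distrib_right)
  finally show "head_norm m' n' (\<lambda>\<nu>. norm (\<Sum>i<n. (t i \<nu> + u i \<nu>) * x i) * w \<nu>)
    \<le> (D + D') * head_norm m n (\<lambda>i. norm (x i) * v i)" .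
qed

lemma matrix_bound_sum:
  assumes "finite J" "\<And>j. j \<in> J \<Longrightarrow> matrix_bound m n v m' n' w (t j) (D j)" and w: "\<And>\<nu>. 0 \<le> w \<nu>"
  shows "matrix_bound m n v m' n' w (\<lambda>i \<nu>. \<Sum>j\<in>J. t j i \<nu>) (\<Sum>j\<in>J. D j)"
  using assms(1,2)
proof (induction J)
  case empty
  then show ?case by (simp add: matrix_bound_def)
next
  case (insert j J)
  then show ?case using matrix_bound_add[of m n v m' n' w "t j" "D j", OF _ _ w] by simp
qed

lemma matrix_bound_weaken:
  assumes "matrix_bound m n v m' n' w t D" "D \<le> D'" and v: "\<And>i. 0 \<le> v i"
  shows "matrix_bound m n v m' n' w t D'"
proof -
  have "D * head_norm m n (\<lambda>i. norm (x i) * v i) \<le> D' * head_norm m n (\<lambda>i. norm (x i) * v i)" for x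
    using assms(2) v by (intro mult_right_mono head_norm_nonneg) auto
  then show ?thesis using assms(1) unfolding matrix_bound_def by (blast intro: order_trans)
qed

text \<open>Composition with a diagonal operator on each side, of norms at most \<open>c\<close> and
  \<open>d\<close> between the old and the new weights. The two norm bounds are stated as products
  rather than quotients, because weights may be zero.\<close>

lemma matrix_bound_diagonal:
  fixes \<alpha> \<beta> :: "nat \<Rightarrow> real" and t :: "nat \<Rightarrow> nat \<Rightarrow> 'k::real_normed_field"
  assumes t: "matrix_bound m n v m' n' w t D" and nonneg: "0 \<le> c" "0 \<le> d" "0 \<le> D"
    and \<alpha>: "\<And>i. \<bar>\<alpha> i\<bar> * v i \<le> c * v' i" and \<beta>: "\<And>\<nu>. \<bar>\<beta> \<nu>\<bar> * w' \<nu> \<le> d * w \<nu>"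
  shows "matrix_bound m n v' m' n' w' (\<lambda>i \<nu>. of_real (\<alpha> i * \<beta> \<nu>) * t i \<nu>) (c * d * D)"
  unfolding matrix_bound_def
proof
  fix x :: "nat \<Rightarrow> 'k"
  define z where "z i = of_real (\<alpha> i) * x i" for i
  have eq: "(\<Sum>i<n. of_real (\<alpha> i * \<beta> \<nu>) * t i \<nu> * x i) = of_real (\<beta> \<nu>) * (\<Sum>i<n. t i \<nu> * z i)" for \<nu>
    by (simp add: z_def sum_distrib_left mult_ac)
  have "norm (\<Sum>i<n. of_real (\<alpha> i * \<beta> \<nu>) * t i \<nu> * x i) * w' \<nu>
      \<le> d * (norm (\<Sum>i<n. t i \<nu> * z i) * w \<nu>)" for \<nu>
    unfolding eq using mult_left_mono[OF \<beta>[of \<nu>], of "norm (\<Sum>i<n. t i \<nu> * z i)"]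
    by (simp add: norm_mult mult_ac)
  then have "head_norm m' n' (\<lambda>\<nu>. norm (\<Sum>i<n. of_real (\<alpha> i * \<beta> \<nu>) * t i \<nu> * x i) * w' \<nu>)
      \<le> d * head_norm m' n' (\<lambda>\<nu>. norm (\<Sum>i<n. t i \<nu> * z i) * w \<nu>)"
    by (subst head_norm_scale[OF nonneg(2), symmetric]) (rule head_norm_mono)
  also have "\<dots> \<le> d * (D * head_norm m n (\<lambda>i. norm (z i) * v i))"
    using nonneg t by (intro mult_left_mono matrix_boundD)
  also have "\<dots> \<le> d * (D * (c * head_norm m n (\<lambda>i. norm (x i) * v' i)))"
  proof -
    have "norm (z i) * v i \<le> c * (norm (x i) * v' i)" for i
      using mult_left_mono[OF \<alpha>[of i], of "norm (x i)"] by (simp add: z_def norm_mult mult_ac)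
    then show ?thesis
      using nonneg by (intro mult_left_mono) (subst head_norm_scale[OF nonneg(1), symmetric], rule head_norm_mono)
  qed
  finally show "head_norm m' n' (\<lambda>\<nu>. norm (\<Sum>i<n. of_real (\<alpha> i * \<beta> \<nu>) * t i \<nu> * x i) * w' \<nu>)
      \<le> c * d * D * head_norm m n (\<lambda>i. norm (x i) * v' i)" by (simp add: mult_ac)
qed

text \<open>The classes are separated one at a time, and since each step is an average of two
  matrices with bound \<open>D\<close>, the bound never grows, however many classes there are. In
  the application a class is a tuple of dyadic levels, so that several level conditions are imposed
  by a single cut.\<close>

lemma matrix_bound_block_diagonal:
  fixes t :: "nat \<Rightarrow> nat \<Rightarrow> 'k::real_normed_field" and f g :: "nat \<Rightarrow> 'c"
  assumes t: "matrix_bound m n v m' n' w t D" and D: "0 \<le> D"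
    and v: "\<And>i. 0 \<le> v i" and w: "\<And>\<nu>. 0 \<le> w \<nu>"
  shows "matrix_bound m n v m' n' w (\<lambda>i \<nu>. if f i = g \<nu> then t i \<nu> else 0) D"
proof -
  have partial: "matrix_bound m n v m' n' w
      (\<lambda>i \<nu>. if f i \<in> L \<or> g \<nu> \<in> L \<longrightarrow> f i = g \<nu> then t i \<nu> else 0) D" if "finite L" for L
    using that
  proof induction
    case empty
    then show ?case using t by simp
  next
    case (insert c L)
    let ?u = "\<lambda>i \<nu>. if f i \<in> L \<or> g \<nu> \<in> L \<longrightarrow> f i = g \<nu> then t i \<nu> else 0"
    txt \<open>Removing the entries between the class of \<open>c\<close> and the other classes averages the matrix with
      its image under sign changes of the class of \<open>c\<close> in both indices.\<close>
    define \<epsilon> \<delta> :: "nat \<Rightarrow> real"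
      where "\<epsilon> i = (if f i = c then - 1 else 1)" and "\<delta> \<nu> = (if g \<nu> = c then - 1 else 1)" for i \<nu>
    have "matrix_bound m n v m' n' w (\<lambda>i \<nu>. of_real ((1 / 2) * 1) * ?u i \<nu>) ((1 / 2) * 1 * D)"
      by (rule matrix_bound_diagonal[OF insert.IH]) (use D v w in auto)
    moreover have "matrix_bound m n v m' n' w (\<lambda>i \<nu>. of_real ((\<epsilon> i / 2) * \<delta> \<nu>) * ?u i \<nu>) ((1 / 2) * 1 * D)"
      by (rule matrix_bound_diagonal[OF insert.IH]) (use D v w in \<open>auto simp: \<epsilon>_def \<delta>_def\<close>)
    ultimately have "matrix_bound m n v m' n' w
        (\<lambda>i \<nu>. of_real ((1 / 2) * 1) * ?u i \<nu> + of_real ((\<epsilon> i / 2) * \<delta> \<nu>) * ?u i \<nu>)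
        ((1 / 2) * 1 * D + (1 / 2) * 1 * D)"
      using w by (rule matrix_bound_add)
    moreover have "of_real ((1 / 2) * 1) * ?u i \<nu> + of_real ((\<epsilon> i / 2) * \<delta> \<nu>) * ?u i \<nu>
      = (if f i \<in> insert c L \<or> g \<nu> \<in> insert c L \<longrightarrow> f i = g \<nu> then t i \<nu> else 0)" for i \<nu>
    proof -
      have "(1 / 2) * 1 + (\<epsilon> i / 2) * \<delta> \<nu> = of_bool ((f i = c) = (g \<nu> = c))"
        by (simp add: \<epsilon>_def \<delta>_def)
      then have "of_real ((1 / 2) * 1) * ?u i \<nu> + of_real ((\<epsilon> i / 2) * \<delta> \<nu>) * ?u i \<nu>
          = of_real (of_bool ((f i = c) = (g \<nu> = c))) * ?u i \<nu>"
        by (simp only: distrib_right[symmetric] of_real_add[symmetric])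
      also have "\<dots> = (if f i \<in> insert c L \<or> g \<nu> \<in> insert c L \<longrightarrow> f i = g \<nu> then t i \<nu> else 0)"
        by (cases "f i = c"; cases "g \<nu> = c") auto
      finally show ?thesis .
    qed
    ultimately show ?case by simp
  qed
  \<comment> \<open>Once \<open>L\<close> lists every class met by the section, the premise
    \<open>f i \<in> L \<or> g \<nu> \<in> L\<close> holds for all its entries.\<close>
  show ?thesis
    by (rule matrix_bound_cong[OF partial[of "f ` {..<n} \<union> g ` {..<n'}"]]) auto
qed

text \<open>The 2 is the loss from rounding to dyadic levels. A nonempty set \<open>B\<close>
  carries one piece for each assignment of gaps to its elements, and a gap \<open>k\<close> costs
  \<open>r ^ k\<close> with \<open>r\<close> the root below; summing over all gaps gives one
  geometric series \<open>1 / (1 - r)\<close> per element of \<open>B\<close>.\<close>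

definition interpolation_constant :: "nat \<Rightarrow> real" where
  "interpolation_constant P =
     (\<Sum>B\<in>Pow {..P} - {{}}. 2 * (1 / (1 - root (Suc P) (1 / 2))) ^ card B)"

lemma interpolation_constant_nonneg: "0 \<le> interpolation_constant P"
proof -
  have "root (Suc P) (1 / 2) \<le> 1" by (subst real_root_le_1_iff) auto
  then show ?thesis unfolding interpolation_constant_def by (intro sum_nonneg) simp
qed

text \<open>This is the expansion of a product of factors \<open>1 - h p\<close>, where
  \<open>h p\<close> counts the \<open>k \<le> K\<close> with \<open>H p k\<close>. The product
  vanishes because \<open>h p = 1\<close> for the given \<open>p\<close>, and the term of the empty
  set is the 1 on the right.\<close>

lemma inclusion_exclusion_indicator:
  fixes H :: "'p \<Rightarrow> nat \<Rightarrow> bool"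
  assumes "finite I" and unique: "\<And>p k l. H p k \<Longrightarrow> H p l \<Longrightarrow> k = l"
    and p: "p \<in> I" "k \<le> K" "H p k"
  shows "(\<Sum>B\<in>Pow I - {{}}. \<Sum>f\<in>PiE B (\<lambda>_. {..K}). (- 1) ^ Suc (card B) * of_bool (\<forall>p\<in>B. H p (f p)))
    = (1 :: real)"
proof -
  let ?h = "\<lambda>p. \<Sum>k\<le>K. of_bool (H p k) :: real"
  have "H p l \<longleftrightarrow> l = k" for l using unique[OF p(3)] p(3) by blast
  then have "?h p = 1" using p(2) by (simp add: of_bool_def)
  then have "(\<Prod>p\<in>I. - ?h p + 1) = 0" using \<open>finite I\<close> p(1) by (intro prod_zero bexI[of _ p]) auto
  also have "(\<Prod>p\<in>I. - ?h p + 1) = (\<Sum>B\<in>Pow I. (\<Prod>p\<in>B. - ?h p) * (\<Prod>p\<in>I - B. 1))"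
    using \<open>finite I\<close> by (rule prod_add)
  also have "\<dots> = (\<Sum>B\<in>Pow I. \<Sum>f\<in>PiE B (\<lambda>_. {..K}). (- 1) ^ card B * of_bool (\<forall>p\<in>B. H p (f p)))"
  proof (intro sum.cong refl)
    fix B assume "B \<in> Pow I"
    then have B: "finite B" using \<open>finite I\<close> finite_subset by auto
    have "(\<Prod>p\<in>B. - ?h p) = (- 1) ^ card B * (\<Prod>p\<in>B. ?h p)"
      using prod.distrib[of "\<lambda>_. - 1" ?h B] by simp
    also have "(\<Prod>p\<in>B. ?h p) = (\<Sum>f\<in>PiE B (\<lambda>_. {..K}). \<Prod>p\<in>B. of_bool (H p (f p)))"
      using B by (intro prod_sum_PiE) auto
    also have "\<dots> = (\<Sum>f\<in>PiE B (\<lambda>_. {..K}). of_bool (\<forall>p\<in>B. H p (f p)))"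
      using B by (intro sum.cong refl) (auto simp: prod_zero_iff)
    finally show "(\<Prod>p\<in>B. - ?h p) * (\<Prod>p\<in>I - B. 1)
      = (\<Sum>f\<in>PiE B (\<lambda>_. {..K}). (- 1) ^ card B * of_bool (\<forall>p\<in>B. H p (f p)))"
      by (simp add: sum_distrib_left)
  qed
  also have "\<dots> = 1 + (\<Sum>B\<in>Pow I - {{}}. \<Sum>f\<in>PiE B (\<lambda>_. {..K}). (- 1) ^ card B * of_bool (\<forall>p\<in>B. H p (f p)))"
    using \<open>finite I\<close> by (subst sum.remove[of _ "{}"]) auto
  finally show ?thesis by (simp add: sum_negf)
qed

text \<open>Each \<open>p\<close> yields a bound between its own pair of weights, while
  \<open>cover\<close> picks a \<open>p\<close> separately for each entry. A piece fixes the gaps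
  between the levels of column and row for all \<open>p\<close> in a set \<open>B\<close>; it is a
  block diagonal cut, so any \<open>q\<close> in \<open>B\<close> may be used to estimate it. The
  alternating sum over all \<open>B\<close> and all gaps restores every entry for which some
  \<open>p\<close> has a nonnegative gap, and \<open>cover\<close> says that these are all entries
  that matter.\<close>

theorem matrix_bound_interpolate:
  fixes t :: "nat \<Rightarrow> nat \<Rightarrow> 'k::real_normed_field" and a b :: "nat \<Rightarrow> nat \<Rightarrow> real"
  assumes nonneg: "\<And>i p. 0 \<le> a i p" "\<And>\<nu> p. 0 \<le> b \<nu> p" "\<And>i. 0 \<le> s i" "\<And>\<nu>. 0 \<le> w \<nu>" "0 \<le> D"
    and t: "\<And>p. p \<le> P \<Longrightarrow> matrix_bound m n (\<lambda>i. a i p) m' n' (\<lambda>\<nu>. b \<nu> p) t D"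
    and cover: "\<And>i \<nu>. w \<nu> = 0 \<or> t i \<nu> = 0 \<or> (\<exists>p\<le>P. 0 < a i p \<and> 0 < b \<nu> p \<and> w \<nu> * a i p \<le> s i * b \<nu> p)"
  shows "matrix_bound m n s m' n' w t (interpolation_constant P * D)"
proof -
  \<comment> \<open>At vanishing weights these levels are junk values; \<open>hit\<close> demands
    positive weights and never uses them.\<close>
  define l l' where "l i p = \<lfloor>log 2 (a i p / s i)\<rfloor>" and "l' \<nu> p = \<lfloor>log 2 (b \<nu> p / w \<nu>)\<rfloor>" for i \<nu> p
  define hit where "hit i \<nu> p k \<longleftrightarrow> 0 < s i \<and> 0 < a i p \<and> 0 < w \<nu> \<and> 0 < b \<nu> p \<and> l' \<nu> p = l i p + int k"
    for i \<nu> p and k :: nat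
  define piece :: "nat set \<Rightarrow> (nat \<Rightarrow> nat) \<Rightarrow> nat \<Rightarrow> nat \<Rightarrow> 'k"
    where "piece B f i \<nu> = (if \<forall>p\<in>B. hit i \<nu> p (f p) then t i \<nu> else 0)" for B f i \<nu>
  define r where "r = root (Suc P) (1 / 2 :: real)"
  have "0 \<le> r" and r_less: "r < 1" unfolding r_def by (simp_all add: real_root_lt_1_iff)
  have r_pow: "r ^ Suc P = 1 / 2" unfolding r_def by (rule real_root_pow_pos2) auto

  have piece_bound: "matrix_bound m n s m' n' w (piece B f) (2 * (1 / 2) ^ f q * D)"
    if q: "q \<in> B" "q \<le> P" for B f q
  proof -
    \<comment> \<open>On the entries of the piece the exponents of \<open>\<alpha> i\<close> and
      \<open>\<beta> \<nu>\<close> cancel, so the product is 1. Passing from \<open>a i q\<close> to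
      \<open>s i\<close> costs the factor 2 of the floor, and passing from \<open>b \<nu> q\<close>
      to \<open>w \<nu>\<close> gains \<open>(1 / 2) ^ f q\<close>. The case distinction removes
      indices with a zero weight.\<close>
    define \<alpha> where "\<alpha> i = (if \<forall>p\<in>B. 0 < s i \<and> 0 < a i p then 2 powr (- real_of_int (l i q)) else 0)" for i
    define \<beta> where "\<beta> \<nu> = (if \<forall>p\<in>B. 0 < w \<nu> \<and> 0 < b \<nu> p then 2 powr (real_of_int (l' \<nu> q) - real (f q)) else 0)" for \<nu>
    \<comment> \<open>Equality of these restricted functions expresses all gap conditions for
      \<open>p \<in> B\<close> at once.\<close>
    let ?F = "\<lambda>i. restrict (l i) B" and ?G = "\<lambda>\<nu>. restrict (\<lambda>p. l' \<nu> p - int (f p)) B"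
    have block: "matrix_bound m n (\<lambda>i. a i q) m' n' (\<lambda>\<nu>. b \<nu> q) (\<lambda>i \<nu>. if ?F i = ?G \<nu> then t i \<nu> else 0) D"
      using t[OF q(2)] nonneg by (intro matrix_bound_block_diagonal)
    have "\<bar>\<alpha> i\<bar> * a i q \<le> 2 * s i" for i
    proof (cases "\<forall>p\<in>B. 0 < s i \<and> 0 < a i p")
      case True
      then have pos: "0 < s i" "0 < a i q" using q by auto
      then have "a i q / s i = 2 powr log 2 (a i q / s i)" by simp
      also have "\<dots> \<le> 2 powr (l i q + 1)" unfolding l_def by (intro powr_mono) linarith+
      also have "\<dots> = 2 * 2 powr l i q" by (simp add: powr_add)
      finally have "a i q \<le> 2 * 2 powr l i q * s i" using pos by (simp add: field_simps)
      then have "2 powr (- real_of_int (l i q)) * a i q \<le> 2 powr (- real_of_int (l i q)) * (2 * 2 powr l i q * s i)"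
        by (intro mult_left_mono) auto
      also have "\<dots> = 2 * s i" by (simp add: powr_minus field_simps)
      finally show ?thesis using True by (simp add: \<alpha>_def)
    qed (use nonneg in \<open>auto simp: \<alpha>_def\<close>)
    moreover have "\<bar>\<beta> \<nu>\<bar> * w \<nu> \<le> (1 / 2) ^ f q * b \<nu> q" for \<nu>
    proof (cases "\<forall>p\<in>B. 0 < w \<nu> \<and> 0 < b \<nu> p")
      case True
      then have pos: "0 < w \<nu>" "0 < b \<nu> q" using q by auto
      have "2 powr l' \<nu> q \<le> 2 powr log 2 (b \<nu> q / w \<nu>)" unfolding l'_def by (intro powr_mono) auto
      also have "\<dots> = b \<nu> q / w \<nu>" using pos by simp
      finally have "2 powr l' \<nu> q * w \<nu> \<le> b \<nu> q" using pos by (simp add: field_simps)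
      then show ?thesis using True
        by (simp add: \<beta>_def powr_diff powr_realpow power_one_over field_simps)
    qed (use nonneg in \<open>auto simp: \<beta>_def\<close>)
    ultimately have "matrix_bound m n s m' n' w
        (\<lambda>i \<nu>. of_real (\<alpha> i * \<beta> \<nu>) * (if ?F i = ?G \<nu> then t i \<nu> else 0)) (2 * (1 / 2) ^ f q * D)"
      using nonneg by (intro matrix_bound_diagonal[OF block]) auto
    moreover have "of_real (\<alpha> i * \<beta> \<nu>) * (if ?F i = ?G \<nu> then t i \<nu> else 0) = piece B f i \<nu>" for i \<nu>
    proof (cases "\<forall>p\<in>B. hit i \<nu> p (f p)")
      case True
      then have "?F i = ?G \<nu>" by (intro restrict_ext) (auto simp: hit_def)
      moreover have "\<alpha> i * \<beta> \<nu> = 1"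
        using True q by (auto simp: hit_def \<alpha>_def \<beta>_def powr_add[symmetric])
      moreover have "piece B f i \<nu> = t i \<nu>" unfolding piece_def by (rule if_P[OF True])
      ultimately show ?thesis by (simp only: of_real_1 if_True mult_1 refl)
    next
      case False
      have "\<alpha> i * \<beta> \<nu> = 0" if "?F i = ?G \<nu>"
      proof (rule ccontr)
        assume "\<alpha> i * \<beta> \<nu> \<noteq> 0"
        then have "\<forall>p\<in>B. 0 < s i \<and> 0 < a i p" "\<forall>p\<in>B. 0 < w \<nu> \<and> 0 < b \<nu> p"
          by (auto simp: \<alpha>_def \<beta>_def simp del: ball_simps split: if_splits)
        moreover have "l i p = l' \<nu> p - int (f p)" if "p \<in> B" for p
          using fun_cong[OF \<open>?F i = ?G \<nu>\<close>, of p] that by simp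
        ultimately have "\<forall>p\<in>B. hit i \<nu> p (f p)" by (simp add: hit_def)
        with False show False by contradiction
      qed
      then have "of_real (\<alpha> i * \<beta> \<nu>) * (if ?F i = ?G \<nu> then t i \<nu> else 0) = 0" by auto
      moreover have "piece B f i \<nu> = 0" unfolding piece_def by (rule if_not_P[OF False])
      ultimately show ?thesis by simp
    qed
    ultimately show ?thesis by simp
  qed

  have piece_bound': "matrix_bound m n s m' n' w (\<lambda>i \<nu>. of_real ((- 1) ^ Suc (card B) * 1) * piece B f i \<nu>)
      (1 * 1 * (2 * (\<Prod>p\<in>B. r ^ f p) * D))" if B: "B \<in> Pow {..P} - {{}}" for B f
  proof (rule matrix_bound_diagonal)
    \<comment> \<open>The piece is estimated through a \<open>q\<close> with the largest gap. As
      \<open>B\<close> has at most \<open>Suc P\<close> elements, \<open>Suc P * f q\<close> is at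
      least the sum of all gaps, so the gain \<open>(1 / 2) ^ f q\<close> is at most the product of
      the \<open>r ^ f p\<close>, which can be summed over \<open>f\<close>.\<close>
    have "finite B" using B finite_subset by auto
    then have "Max (f ` B) \<in> f ` B" using B by (intro Max_in) auto
    then obtain q where q: "q \<in> B" "Max (f ` B) = f q" by blast
    then have "f p \<le> f q" if "p \<in> B" for p using that \<open>finite B\<close> Max_ge[of "f ` B" "f p"] by simp
    then have "sum f B \<le> card B * f q" using sum_bounded_above[of B f "f q"] by simp
    also have "\<dots> \<le> Suc P * f q"
      using B card_mono[of "{..P}" B] by (intro mult_right_mono) auto
    finally have "(r ^ Suc P) ^ f q \<le> r ^ sum f B"
      unfolding power_mult[symmetric] using \<open>0 \<le> r\<close> r_less by (intro power_decreasing) auto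
    then have "(1 / 2) ^ f q \<le> (\<Prod>p\<in>B. r ^ f p)" unfolding r_pow by (simp add: power_sum)
    then show "matrix_bound m n s m' n' w (piece B f) (2 * (\<Prod>p\<in>B. r ^ f p) * D)"
      using B q nonneg by (intro matrix_bound_weaken[OF piece_bound[of q]] mult_right_mono) auto
  qed (use nonneg \<open>0 \<le> r\<close> in \<open>auto intro!: prod_nonneg mult_nonneg_nonneg\<close>)

  \<comment> \<open>\<open>K\<close> bounds all gaps in the given finite section, so only finitely
    many \<open>f\<close> are needed. It depends on the section and must not survive in the
    constant.\<close>
  define K where "K = (\<Sum>i<n. \<Sum>\<nu><n'. \<Sum>p\<le>P. nat (l' \<nu> p - l i p))"
  have K: "nat (l' \<nu> p - l i p) \<le> K" if "i < n" "\<nu> < n'" "p \<le> P" for i \<nu> p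
  proof -
    have "nat (l' \<nu> p - l i p) \<le> (\<Sum>p\<le>P. nat (l' \<nu> p - l i p))"
      using that by (intro member_le_sum) auto
    also have "\<dots> \<le> (\<Sum>\<nu><n'. \<Sum>p\<le>P. nat (l' \<nu> p - l i p))"
      using that by (intro member_le_sum[of \<nu> "{..<n'}" "\<lambda>\<nu>. \<Sum>p\<le>P. nat (l' \<nu> p - l i p)"]) auto
    also have "\<dots> \<le> K"
      unfolding K_def using that
      by (intro member_le_sum[of i "{..<n}" "\<lambda>i. \<Sum>\<nu><n'. \<Sum>p\<le>P. nat (l' \<nu> p - l i p)"]) auto
    finally show ?thesis .
  qed

  let ?J = "SIGMA B:Pow {..P} - {{}}. PiE B (\<lambda>_. {..K})"
  have finite_J: "finite ?J"
    by (intro finite_SigmaI finite_PiE) (auto intro: finite_subset)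
  have "matrix_bound m n s m' n' w
      (\<lambda>i \<nu>. \<Sum>(B, f)\<in>?J. of_real ((- 1) ^ Suc (card B) * 1) * piece B f i \<nu>)
      (\<Sum>(B, f)\<in>?J. 1 * 1 * (2 * (\<Prod>p\<in>B. r ^ f p) * D))"
    unfolding case_prod_beta
    by (intro matrix_bound_sum finite_J piece_bound' nonneg) (erule SigmaE, simp)
  moreover have "(\<Sum>(B, f)\<in>?J. of_real ((- 1) ^ Suc (card B) * 1) * piece B f i \<nu>) = t i \<nu>"
    if "i < n" "\<nu> < n'" "w \<nu> \<noteq> 0" for i \<nu>
  proof (cases "t i \<nu> = 0")
    case True
    show ?thesis unfolding True by (intro sum.neutral) (auto simp: piece_def True)
  next
    case False
    with that cover obtain p where p: "p \<le> P" "0 < a i p" "0 < b \<nu> p" "w \<nu> * a i p \<le> s i * b \<nu> p" by blast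
    have w: "0 < w \<nu>" using nonneg(4)[of \<nu>] that by simp
    then have "0 < s i * b \<nu> p" using p by (meson less_le_trans mult_pos_pos)
    then have s: "0 < s i" using p by (simp add: zero_less_mult_iff)
    \<comment> \<open>The covering inequality compares the quotients that define the levels, so the
      gap at this \<open>p\<close> is nonnegative and is registered by \<open>hit\<close>.\<close>
    have "log 2 (a i p / s i) \<le> log 2 (b \<nu> p / w \<nu>)"
      using p w s by (subst log_le_cancel_iff) (auto simp: field_simps)
    then have "l i p \<le> l' \<nu> p" unfolding l_def l'_def by (rule floor_mono)
    then have hit: "hit i \<nu> p (nat (l' \<nu> p - l i p))" using p w s by (simp add: hit_def)
    have "(\<Sum>(B, f)\<in>?J. of_real ((- 1) ^ Suc (card B) * 1) * piece B f i \<nu>)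
        = of_real (\<Sum>(B, f)\<in>?J. (- 1) ^ Suc (card B) * of_bool (\<forall>p\<in>B. hit i \<nu> p (f p))) * t i \<nu>"
    proof -
      have "of_real ((- 1) ^ Suc (card B) * 1) * piece B f i \<nu>
          = of_real ((- 1) ^ Suc (card B) * of_bool (\<forall>p\<in>B. hit i \<nu> p (f p))) * t i \<nu>" for B f
        by (simp add: piece_def of_bool_def)
      then show ?thesis unfolding of_real_sum sum_distrib_right case_prod_beta by (intro sum.cong refl)
    qed
    also have "(\<Sum>(B, f)\<in>?J. (- 1) ^ Suc (card B) * of_bool (\<forall>p\<in>B. hit i \<nu> p (f p)))
        = (\<Sum>B\<in>Pow {..P} - {{}}. \<Sum>f\<in>PiE B (\<lambda>_. {..K}). (- 1) ^ Suc (card B) * of_bool (\<forall>p\<in>B. hit i \<nu> p (f p)) :: real)"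
      by (subst sum.Sigma) (auto intro!: finite_PiE intro: finite_subset)
    also have "\<dots> = 1"
      using K[OF that(1,2) p(1)] hit p(1)
      by (intro inclusion_exclusion_indicator[where p = p]) (auto simp: hit_def)
    finally show ?thesis by simp
  qed
  ultimately have bound: "matrix_bound m n s m' n' w t (\<Sum>(B, f)\<in>?J. 1 * 1 * (2 * (\<Prod>p\<in>B. r ^ f p) * D))"
    by (rule matrix_bound_cong)
  have "(\<Sum>(B, f)\<in>?J. 1 * 1 * (2 * (\<Prod>p\<in>B. r ^ f p) * D))
      = (\<Sum>B\<in>Pow {..P} - {{}}. \<Sum>f\<in>PiE B (\<lambda>_. {..K}). 2 * (\<Prod>p\<in>B. r ^ f p) * D)"
    by (subst sum.Sigma) (auto intro!: finite_PiE intro: finite_subset)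
  also have "\<dots> = (\<Sum>B\<in>Pow {..P} - {{}}. 2 * (\<Sum>k\<le>K. r ^ k) ^ card B * D)"
  proof (intro sum.cong refl)
    fix B assume "B \<in> Pow {..P} - {{}}"
    then have "finite B" using finite_subset by auto
    then have "(\<Prod>p\<in>B. \<Sum>k\<le>K. r ^ k) = (\<Sum>f\<in>PiE B (\<lambda>_. {..K}). \<Prod>p\<in>B. r ^ f p)"
      by (intro prod_sum_PiE) auto
    then show "(\<Sum>f\<in>PiE B (\<lambda>_. {..K}). 2 * (\<Prod>p\<in>B. r ^ f p) * D) = 2 * (\<Sum>k\<le>K. r ^ k) ^ card B * D"
      by (simp add: sum_distrib_left sum_distrib_right)
  qed
  \<comment> \<open>Replacing the partial geometric sums by the full series eliminates
    \<open>K\<close>, and with it the dependence on the section.\<close>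
  also have "\<dots> \<le> (\<Sum>B\<in>Pow {..P} - {{}}. 2 * (1 / (1 - r)) ^ card B * D)"
  proof -
    have "(\<Sum>k\<le>K. r ^ k) \<le> (\<Sum>k. r ^ k)"
      using \<open>0 \<le> r\<close> r_less by (intro sum_le_suminf summable_geometric) auto
    also have "\<dots> = 1 / (1 - r)" using \<open>0 \<le> r\<close> r_less by (intro suminf_geometric) auto
    finally show ?thesis
      using nonneg(5) \<open>0 \<le> r\<close>
      by (intro sum_mono mult_right_mono mult_left_mono power_mono) (auto intro: sum_nonneg)
  qed
  also have "\<dots> = interpolation_constant P * D"
    by (simp add: interpolation_constant_def r_def sum_distrib_right)
  finally show ?thesis using bound nonneg(3) by (intro matrix_bound_weaken[OF bound])
qed

section \<open>Sufficiency\<close>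

definition unit_seq :: "nat \<Rightarrow> nat \<Rightarrow> 'k::zero_neq_one" where
  "unit_seq i = (\<lambda>j. if j = i then 1 else 0)"

lemma unit_seq_in_kothe_space:
  assumes "kothe_matrix A"
  shows "unit_seq i \<in> space_of (kothe_space m A)"
proof -
  have "head_seq (Suc i) (unit_seq i) = unit_seq i" by (auto simp: head_seq_def unit_seq_def)
  then show ?thesis using head_seq_in_kothe_space[OF assms] by metis
qed

lemma seminorm_unit_seq:
  assumes A: "kothe_matrix A"
  shows "seminorm (kothe_space m A) (unit_seq i :: nat \<Rightarrow> 'k::real_normed_field) k = A i k"
proof -
  have "head_seq (Suc i) (unit_seq i) = (unit_seq i :: nat \<Rightarrow> 'k)"
    by (auto simp: head_seq_def unit_seq_def)
  then have "seminorm (kothe_space m A) (unit_seq i :: nat \<Rightarrow> 'k) k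
      = kothe_head_norm m A (Suc i) k (unit_seq i :: nat \<Rightarrow> 'k)"
    using seminorm_head_seq[OF A, of m "Suc i" "unit_seq i" k] by metis
  also have "\<dots> = head_norm m (Suc i) (\<lambda>j. if j = i then A i k else 0)"
    by (intro head_norm_cong) (auto simp: unit_seq_def)
  finally show ?thesis using A by (simp add: head_norm_single kothe_matrix_nonneg)
qed

lemma operator_head_seq:
  fixes Q :: "(nat \<Rightarrow> 'k::real_normed_field) \<Rightarrow> nat \<Rightarrow> 'k"
  assumes A: "kothe_matrix A" and Q: "Q \<in> continuous_operators (kothe_space m A) (kothe_space m' B)"
  shows "Q (head_seq n x) \<nu> = (\<Sum>i<n. Q (unit_seq i) \<nu> * x i)"
proof (induction n)
  case 0
  interpret seminormed "kothe_space m A :: 'k sequence_space" by (rule kothe_space_seminormed[OF A])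
  have "Q (0 - 0) = Q 0 - Q 0"
    using continuous_operators_diff[OF kothe_space_seminormed[OF A] Q zero_in zero_in] .
  moreover have "head_seq 0 x = 0" by (simp add: head_seq_def fun_eq_iff)
  ultimately show ?case by (metis cancel_comm_monoid_add_class.diff_cancel lessThan_0 sum.empty zero_fun_apply)
next
  case (Suc n)
  have eq: "head_seq (Suc n) x = head_seq n x + (\<lambda>j. x n * unit_seq n j)"
    by (auto simp: head_seq_def unit_seq_def fun_eq_iff less_Suc_eq)
  have "Q (head_seq n x + (\<lambda>j. x n * unit_seq n j)) = Q (head_seq n x) + Q (\<lambda>j. x n * unit_seq n j)"
    using Q head_seq_in_kothe_space[OF A] kothe_seminorm_scale_le(1)[OF A unit_seq_in_kothe_space[OF A]]
    unfolding continuous_operators_def by blast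
  moreover have "Q (\<lambda>j. x n * unit_seq n j) = (\<lambda>j. x n * Q (unit_seq n) j)"
  proof -
    have "unit_seq n \<in> space_of (kothe_space m A :: 'k sequence_space)"
      by (rule unit_seq_in_kothe_space[OF A])
    then show ?thesis using Q unfolding continuous_operators_def by simp
  qed
  ultimately have "Q (head_seq (Suc n) x) \<nu> = (Q (head_seq n x) + (\<lambda>j. x n * Q (unit_seq n) j)) \<nu>"
    by (simp only: eq)
  then show ?case by (simp add: Suc.IH mult.commute)
qed

lemma operator_matrix_bound:
  fixes Q :: "(nat \<Rightarrow> 'k::real_normed_field) \<Rightarrow> nat \<Rightarrow> 'k"
  assumes A: "kothe_matrix A" and B: "kothe_matrix B"
    and Q: "Q \<in> continuous_operators (kothe_space m A) (kothe_space m' B)"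
    and D: "\<And>x. x \<in> space_of (kothe_space m A :: 'k sequence_space) \<Longrightarrow>
      seminorm (kothe_space m' B) (Q x) q \<le> D * seminorm (kothe_space m A) x r"
  shows "matrix_bound m n (\<lambda>i. A i r) m' n' (\<lambda>\<nu>. B \<nu> q) (\<lambda>i \<nu>. Q (unit_seq i) \<nu>) D"
  unfolding matrix_bound_def
proof
  fix x :: "nat \<Rightarrow> 'k"
  have in_space: "Q (head_seq n x) \<in> space_of (kothe_space m' B)"
    using Q head_seq_in_kothe_space[OF A, of n x m] by (auto simp: continuous_operators_def)
  have "head_norm m' n' (\<lambda>\<nu>. norm (\<Sum>i<n. Q (unit_seq i) \<nu> * x i) * B \<nu> q)
    \<le> seminorm (kothe_space m' B) (Q (head_seq n x)) q"
    using kothe_head_norm_le_seminorm[OF B in_space] by (simp add: operator_head_seq[OF A Q])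
  also have "\<dots> \<le> D * seminorm (kothe_space m A) (head_seq n x) r"
    by (intro D head_seq_in_kothe_space[OF A])
  finally show "head_norm m' n' (\<lambda>\<nu>. norm (\<Sum>i<n. Q (unit_seq i) \<nu> * x i) * B \<nu> q)
    \<le> D * kothe_head_norm m A n r x" by (simp add: seminorm_head_seq[OF A])
qed

text \<open>Continuity of \<open>T\<close> provides some seminorm \<open>r\<close>, over which there
  is no control; but it is applied only to the tails of \<open>x\<close>, which tend to zero in
  every seminorm. The bound \<open>M\<close> is therefore kept without loss.\<close>

lemma seminorm_le_if_head_seq:
  fixes T :: "(nat \<Rightarrow> 'k::real_normed_field) \<Rightarrow> nat \<Rightarrow> 'k"
  assumes A: "kothe_matrix A" and B: "kothe_matrix B" and m: "m \<noteq> Linf"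
    and T: "T \<in> continuous_operators (kothe_space m A) (kothe_space m' B)"
    and x: "x \<in> space_of (kothe_space m A)"
    and M: "\<And>n. seminorm (kothe_space m' B) (T (head_seq n x)) k \<le> M"
  shows "seminorm (kothe_space m' B) (T x) k \<le> M"
proof -
  interpret E: seminormed "kothe_space m A :: 'k sequence_space" by (rule kothe_space_seminormed[OF A])
  interpret F: seminormed "kothe_space m' B :: 'k sequence_space" by (rule kothe_space_seminormed[OF B])
  obtain r D where D: "\<And>x. x \<in> space_of (kothe_space m A :: 'k sequence_space) \<Longrightarrow>
      seminorm (kothe_space m' B) (T x) k \<le> D * seminorm (kothe_space m A) x r"
    using continuous_operator_imp_bounded[OF E.seminormed_axioms F.seminormed_axioms T] by blast
  have into: "T y \<in> space_of (kothe_space m' B)" if "y \<in> space_of (kothe_space m A)" for y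
    using T that by (auto simp: continuous_operators_def)
  have head: "head_seq n x \<in> space_of (kothe_space m A)" for n
    by (rule head_seq_in_kothe_space[OF A])
  have tail: "x - head_seq n x \<in> space_of (kothe_space m A)" for n
    by (intro E.diff_in x head)
  have "seminorm (kothe_space m' B) (T x) k \<le> M + D * seminorm (kothe_space m A) (x - head_seq n x) r" for n
  proof -
    have "T x = T (head_seq n x) + T (x - head_seq n x)"
      using continuous_operators_diff[OF E.seminormed_axioms T x head, of n] by simp
    then have "seminorm (kothe_space m' B) (T x) k
        \<le> seminorm (kothe_space m' B) (T (head_seq n x)) k + seminorm (kothe_space m' B) (T (x - head_seq n x)) k"
      using F.seminorm_triangle[OF into[OF head] into[OF tail]] by metis
    then show ?thesis using M[of n] D[OF tail, of n] by linarith
  qed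
  moreover have "(\<lambda>n. M + D * seminorm (kothe_space m A) (x - head_seq n x) r) \<longlonglongrightarrow> M + D * 0"
    by (intro tendsto_intros seminorm_tail_tendsto[OF A x m])
  ultimately show ?thesis using LIMSEQ_le_const by fastforce
qed

text \<open>The junk value \<open>x / 0 = 0\<close> of real division is harmless here: it only occurs for \<open>0 / 0\<close>.\<close>

lemma Max_ennreal_divide_cases:
  fixes f g :: "nat \<Rightarrow> real" and P :: nat
  assumes nonneg: "\<And>q. 0 \<le> f q" "\<And>q. 0 \<le> g q"
  defines "M \<equiv> MAX q\<in>{..P}. ennreal (f q) / ennreal (g q)"
  shows "(\<exists>q\<le>P. g q = 0 \<and> 0 < f q) \<and> M = \<infinity> \<or>
    (\<forall>q\<le>P. g q = 0 \<longrightarrow> f q = 0) \<and> M = ennreal (MAX q\<in>{..P}. f q / g q)"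
proof (cases "\<exists>q\<le>P. g q = 0 \<and> 0 < f q")
  case False
  then have zero: "f q = 0" if "q \<le> P" "g q = 0" for q
    using that nonneg(1)[of q] by force
  have "ennreal (f q) / ennreal (g q) = ennreal (f q / g q)" if "q \<le> P" for q
  proof (cases "g q = 0")
    case True
    then show ?thesis using zero[OF that] by simp
  next
    case False
    then have "0 < g q" using nonneg(2)[of q] by simp
    then show ?thesis using nonneg by (simp add: divide_ennreal)
  qed
  then have "M = Max (ennreal ` (\<lambda>q. f q / g q) ` {..P})"
    unfolding M_def image_image by (intro arg_cong[where f = Max] image_cong) auto
  also have "\<dots> = ennreal (MAX q\<in>{..P}. f q / g q)"
    by (intro mono_Max_commute[symmetric]) (auto intro: ennreal_leI monoI)
  finally show ?thesis using zero by blast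
next
  case True
  then obtain q where q: "q \<le> P" "g q = 0" "0 < f q" by blast
  then have "ennreal (f q) / ennreal (g q) = \<infinity>" by simp
  moreover have "ennreal (f q) / ennreal (g q) \<le> M" using q(1) by (simp add: M_def)
  ultimately show ?thesis using True by (simp add: top_unique)
qed

text \<open>For every index \<open>\<nu>\<close> of the middle space the condition separates the indices \<open>i\<close> and \<open>j\<close> by a
  weight, and so provides a seminorm through which the factorization can be estimated.\<close>

lemma exists_middle_weight:
  fixes s b b' c :: "nat \<Rightarrow> real" and a d :: "nat \<Rightarrow> nat \<Rightarrow> real"
  assumes nonneg: "\<And>i. 0 \<le> s i" "\<And>q. 0 \<le> b q" "\<And>q. 0 \<le> b' q" "\<And>i q. 0 \<le> a i q" "\<And>j q. 0 \<le> d j q"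
    and K: "0 < K" and k: "k \<le> P"
    and cond: "\<And>i j. ennreal (d j k) / ennreal (s i) \<le> ennreal K * times_top
      (MAX q\<in>{..P}. ennreal (b q) / ennreal (a i q)) (MAX q\<in>{..P}. ennreal (d j q) / ennreal (b' q))"
  shows "\<exists>w\<ge>0.
    (\<forall>i. w = 0 \<or> (\<exists>q\<le>P. a i q = 0 \<and> 0 < b q) \<or>
      (\<exists>q\<le>P. 0 < a i q \<and> 0 < b q \<and> w * a i q \<le> K * s i * b q)) \<and>
    (\<forall>j. d j k = 0 \<or> (\<exists>q\<le>P. b' q = 0 \<and> 0 < d j q) \<or>
      (\<exists>q\<le>P. 0 < b' q \<and> 0 < d j q \<and> d j k * b' q \<le> w * d j q))"
proof -
  define \<alpha> \<gamma> where "\<alpha> i = (MAX q\<in>{..P}. b q / a i q)" and "\<gamma> j = (MAX q\<in>{..P}. d j q / b' q)" for i j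
  \<comment> \<open>These are the indices with a finite maximum. Outside of them
    \<open>times_top\<close> makes the condition void, and the disjunct with a vanishing denominator
    holds.\<close>
  define I J where "I = {i. \<forall>q\<le>P. a i q = 0 \<longrightarrow> b q = 0}" and "J = {j. \<forall>q\<le>P. b' q = 0 \<longrightarrow> d j q = 0}"
  have Max_attained: "\<exists>q\<le>P. (MAX q\<in>{..P}. f q) = f q" for f :: "nat \<Rightarrow> real"
  proof -
    have "(MAX q\<in>{..P}. f q) \<in> f ` {..P}" by (intro Max_in) auto
    then show ?thesis by blast
  qed
  have \<alpha>: "\<exists>q\<le>P. \<alpha> i = b q / a i q" and \<gamma>: "\<exists>q\<le>P. \<gamma> j = d j q / b' q" for i j
    unfolding \<alpha>_def \<gamma>_def by (rule Max_attained)+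
  have \<alpha>_nonneg: "0 \<le> \<alpha> i" and \<gamma>_nonneg: "0 \<le> \<gamma> j" for i j
    using \<alpha>[of i] \<gamma>[of j] nonneg by auto
  have le: "d j k \<le> K * s i * \<alpha> i * \<gamma> j" if "i \<in> I" "j \<in> J" for i j
  proof -
    have "ennreal (d j k) / ennreal (s i) \<le> ennreal K * times_top (ennreal (\<alpha> i)) (ennreal (\<gamma> j))"
      using cond[of j i] Max_ennreal_divide_cases[of b "a i" P] Max_ennreal_divide_cases[of "d j" b' P]
        that nonneg unfolding \<alpha>_def \<gamma>_def I_def J_def by force
    then have *: "ennreal (d j k) / ennreal (s i) \<le> ennreal (K * (\<alpha> i * \<gamma> j))"
      using K \<alpha>_nonneg \<gamma>_nonneg by (simp add: times_top_def ennreal_mult)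
    show ?thesis
    proof (cases "s i = 0")
      case True
      then have "d j k = 0" using * nonneg(5)[of j k]
        by (cases "d j k = 0") (auto simp: top_unique)
      then show ?thesis using True by simp
    next
      case False
      then have "0 < s i" using nonneg(1)[of i] by simp
      then have "d j k / s i \<le> K * (\<alpha> i * \<gamma> j)"
        using * K \<alpha>_nonneg \<gamma>_nonneg nonneg by (simp add: divide_ennreal)
      then show ?thesis using \<open>0 < s i\<close> by (simp add: field_simps)
    qed
  qed
  \<comment> \<open>Here \<open>k \<le> P\<close> enters: the term \<open>q = k\<close> occurs in
    the maximum \<open>\<gamma> j\<close>. This bounds the supremum below even if \<open>I\<close>
    is empty.\<close>
  have le_b': "d j k / \<gamma> j \<le> b' k" if "j \<in> J" for j
  proof (cases "b' k = 0")
    case True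
    then show ?thesis using that k by (simp add: J_def)
  next
    case False
    have "d j k / b' k \<le> \<gamma> j" using k by (simp add: \<gamma>_def)
    moreover have "0 < b' k" using False nonneg(3)[of k] by simp
    ultimately show ?thesis using \<gamma>_nonneg[of j] nonneg(5)[of j k]
      by (cases "\<gamma> j = 0") (auto simp: field_simps)
  qed
  \<comment> \<open>The least nonnegative weight that serves every \<open>j\<close> in
    \<open>J\<close>; the separated inequality then bounds it for every \<open>i\<close> in
    \<open>I\<close>. If \<open>\<gamma> j = 0\<close>, then \<open>d j k = 0\<close>, so the value
    0 of the real quotient is the right one.\<close>
  define w where "w = Sup (insert 0 ((\<lambda>j. d j k / \<gamma> j) ` J))"
  have bdd: "bdd_above (insert 0 ((\<lambda>j. d j k / \<gamma> j) ` J))"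
    using le_b' nonneg(3) by (auto simp: bdd_above_def intro!: exI[of _ "b' k"])
  have w: "0 \<le> w" "\<And>j. j \<in> J \<Longrightarrow> d j k / \<gamma> j \<le> w"
    unfolding w_def using bdd by (auto intro: cSup_upper)
  have w_le: "w \<le> K * s i * \<alpha> i" if "i \<in> I" for i
    unfolding w_def
  proof (rule cSup_least)
    fix y assume "y \<in> insert 0 ((\<lambda>j. d j k / \<gamma> j) ` J)"
    moreover have "d j k / \<gamma> j \<le> K * s i * \<alpha> i" if "j \<in> J" for j
      using le[OF \<open>i \<in> I\<close> that] K nonneg \<alpha>_nonneg[of i] \<gamma>_nonneg[of j]
      by (cases "\<gamma> j = 0") (auto simp: field_simps)
    ultimately show "y \<le> K * s i * \<alpha> i" using K nonneg \<alpha>_nonneg[of i] by auto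
  qed simp
  have "\<exists>q\<le>P. 0 < a i q \<and> 0 < b q \<and> w * a i q \<le> K * s i * b q" if i: "i \<in> I" "w \<noteq> 0" for i
  proof -
    obtain q where q: "q \<le> P" "\<alpha> i = b q / a i q" using \<alpha> by blast
    have "0 < K * s i * \<alpha> i" using w(1) w_le[OF i(1)] i(2) by linarith
    then have "\<alpha> i \<noteq> 0" by auto
    then have "0 < a i q" "0 < b q" using q nonneg(2)[of q] nonneg(4)[of i q] by (auto simp: less_le)
    moreover from this have "w * a i q \<le> K * s i * b q"
      using w_le[OF i(1)] by (simp add: q(2) field_simps)
    ultimately show ?thesis using q(1) by blast
  qed
  moreover have "\<exists>q\<le>P. 0 < b' q \<and> 0 < d j q \<and> d j k * b' q \<le> w * d j q" if j: "j \<in> J" "d j k \<noteq> 0" for j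
  proof -
    obtain q where q: "q \<le> P" "\<gamma> j = d j q / b' q" using \<gamma> by blast
    have "b' k \<noteq> 0" using j k by (auto simp: J_def)
    then have "0 < d j k / b' k" using j(2) nonneg(3)[of k] nonneg(5)[of j k] by (simp add: less_le)
    also have "\<dots> \<le> \<gamma> j" using k by (simp add: \<gamma>_def)
    finally have "0 < \<gamma> j" .
    then have pos: "0 < b' q" "0 < d j q" using q nonneg(3)[of q] nonneg(5)[of j q] by (auto simp: less_le)
    have "d j k \<le> w * (d j q / b' q)" using w(2)[OF j(1)] \<open>0 < \<gamma> j\<close> by (simp add: q(2)[symmetric] field_simps)
    then show ?thesis using pos q(1) by (auto simp: field_simps)
  qed
  ultimately show ?thesis
    using w(1) nonneg unfolding I_def J_def
    by (intro exI[of _ w]) (simp add: less_le, blast)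
qed

text \<open>Stated for everything above \<open>\<rho>\<close> and \<open>\<Delta>\<close>, so that
  two operators can later share one \<open>\<phi>\<close> and one constant. A larger index is
  admissible by the grading, a larger constant because \<open>\<bar>\<Delta> q\<bar>\<close> is
  nonnegative.\<close>

lemma continuity_bounds_uniform:
  fixes Q :: "'u::ab_group_add \<Rightarrow> 'v::ab_group_add" and E :: "('k::real_normed_field, 'u) graded_space"
  assumes E: "seminormed E" and F: "seminormed F" and Q: "Q \<in> continuous_operators E F"
  shows "\<exists>\<rho> \<Delta>. \<forall>\<phi> q D. \<rho> q \<le> \<phi> q \<and> \<Delta> q \<le> D \<longrightarrow>
    (\<forall>x\<in>space_of E. seminorm F (Q x) q \<le> D * seminorm E x (\<phi> q))"
proof -
  interpret E: seminormed E by fact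
  have "\<forall>q. \<exists>r D. \<forall>x\<in>space_of E. seminorm F (Q x) q \<le> D * seminorm E x r"
    using continuous_operator_imp_bounded[OF E F Q] by blast
  then obtain \<rho> \<Delta> where *: "\<And>q x. x \<in> space_of E \<Longrightarrow> seminorm F (Q x) q \<le> \<Delta> q * seminorm E x (\<rho> q)"
    by metis
  have "seminorm F (Q x) q \<le> D * seminorm E x (\<phi> q)"
    if "\<rho> q \<le> \<phi> q" "\<bar>\<Delta> q\<bar> \<le> D" "x \<in> space_of E" for \<phi> q D x
  proof -
    have "seminorm F (Q x) q \<le> \<bar>\<Delta> q\<bar> * seminorm E x (\<rho> q)"
      using *[OF that(3), of q] mult_right_mono[of "\<Delta> q" "\<bar>\<Delta> q\<bar>" "seminorm E x (\<rho> q)"]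
        E.seminorm_nonneg[OF that(3)] by (meson abs_ge_self order_trans)
    also have "\<dots> \<le> D * seminorm E x (\<phi> q)"
      using that E.seminorm_mono[OF that(3,1)] E.seminorm_nonneg[OF that(3)]
      by (intro mult_mono) auto
    finally show ?thesis .
  qed
  then show ?thesis by (intro exI[of _ \<rho>] exI[of _ "\<lambda>q. \<bar>\<Delta> q\<bar>"]) blast
qed

text \<open>The \<open>S\<close> of the matrix condition serves unchanged. For given
  \<open>T\<close> the condition is applied to a \<open>\<phi>\<close> above the continuity indices
  of both factors, which is how \<open>k0\<close> comes to depend on \<open>T\<close>. At each
  \<open>k\<close> the factors are then estimated separately, \<open>Q\<close> into the middle
  weight \<open>w\<close> and \<open>R\<close> out of it.\<close>

theorem tame_factorization_if_matrix_condition: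
  fixes A B C :: "nat \<Rightarrow> nat \<Rightarrow> real"
  assumes A: "kothe_matrix A" and B: "kothe_matrix B" and C: "kothe_matrix C"
    and m1: "m1 \<noteq> Linf" and m2: "m2 \<noteq> Linf"
    and cond: "tame_matrix_condition A B C"
  shows "tame_factorization (kothe_space m1 A :: 'k::real_normed_field sequence_space)
    (kothe_space m2 B) (kothe_space m3 C)"
proof -
  let ?E = "kothe_space m1 A :: 'k sequence_space" and ?G = "kothe_space m2 B :: 'k sequence_space"
    and ?F = "kothe_space m3 C :: 'k sequence_space"
  have E: "seminormed ?E" and G: "seminormed ?G" and F: "seminormed ?F"
    by (intro kothe_space_seminormed A B C)+
  obtain S :: "nat \<Rightarrow> nat" where "mono S" and S: "\<And>\<phi> :: nat \<Rightarrow> nat. mono \<phi> \<Longrightarrow>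
      \<exists>k0. \<forall>k\<ge>k0. \<exists>qk Ck. 0 < Ck \<and> (\<forall>i j \<nu>.
        ennreal (C j k) / ennreal (A i (S k)) \<le> ennreal Ck * times_top
          (MAX q\<in>{..qk}. ennreal (B \<nu> q) / ennreal (A i (\<phi> q)))
          (MAX q\<in>{..qk}. ennreal (C j q) / ennreal (B \<nu> (\<phi> q))))"
    using cond unfolding tame_matrix_condition_def by blast
  have "\<exists>k0. \<forall>k\<ge>k0. continuity_characteristic ?E ?F T k \<le> enat (S k)"
    if T: "T \<in> operators_through ?E ?G ?F" for T
  proof -
    obtain Q R where Q: "Q \<in> continuous_operators ?E ?G" and R: "R \<in> continuous_operators ?G ?F"
      and T_eq: "\<And>x. x \<in> space_of ?E \<Longrightarrow> T x = R (Q x)"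
      using T unfolding operators_through_def by blast
    obtain \<rho> \<Delta> where Q_bound: "\<And>\<phi> q D x. \<rho> q \<le> \<phi> q \<Longrightarrow> \<Delta> q \<le> D \<Longrightarrow> x \<in> space_of ?E \<Longrightarrow>
        seminorm ?G (Q x) q \<le> D * seminorm ?E x (\<phi> q)"
      using continuity_bounds_uniform[OF E G Q] by metis
    obtain \<rho>' \<Delta>' where R_bound: "\<And>\<phi> q D x. \<rho>' q \<le> \<phi> q \<Longrightarrow> \<Delta>' q \<le> D \<Longrightarrow> x \<in> space_of ?G \<Longrightarrow>
        seminorm ?F (R x) q \<le> D * seminorm ?G x (\<phi> q)"
      using continuity_bounds_uniform[OF G F R] by metis
    \<comment> \<open>Cumulative sums give a monotone function above both index functions.\<close>
    define \<phi> where "\<phi> q = (\<Sum>p\<le>q. \<rho> p + \<rho>' p)" for q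
    have "mono \<phi>" unfolding \<phi>_def by (intro monoI sum_mono2) auto
    have \<phi>: "\<rho> q \<le> \<phi> q" "\<rho>' q \<le> \<phi> q" for q
    proof -
      have "\<rho> q + \<rho>' q \<le> \<phi> q" unfolding \<phi>_def by (intro member_le_sum[of q]) auto
      then show "\<rho> q \<le> \<phi> q" "\<rho>' q \<le> \<phi> q" by simp_all
    qed
    have T_lin: "T x \<in> space_of ?F" "T (scale_of ?E c x) = scale_of ?F c (T x)"
      if "x \<in> space_of ?E" for x c
      using T that unfolding operators_through_def continuous_operators_def by blast+
    obtain k0 where k0: "\<And>k. k0 \<le> k \<Longrightarrow> \<exists>qk Ck. 0 < Ck \<and> (\<forall>i j \<nu>.
        ennreal (C j k) / ennreal (A i (S k)) \<le> ennreal Ck * times_top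
          (MAX q\<in>{..qk}. ennreal (B \<nu> q) / ennreal (A i (\<phi> q)))
          (MAX q\<in>{..qk}. ennreal (C j q) / ennreal (B \<nu> (\<phi> q))))"
      using S[OF \<open>mono \<phi>\<close>] by blast
    have "continuity_characteristic ?E ?F T k \<le> enat (S k)" if k: "k0 \<le> k" for k
    proof -
      obtain qk K where "0 < K" and qk: "\<And>i j \<nu>.
        ennreal (C j k) / ennreal (A i (S k)) \<le> ennreal K * times_top
          (MAX q\<in>{..qk}. ennreal (B \<nu> q) / ennreal (A i (\<phi> q)))
          (MAX q\<in>{..qk}. ennreal (C j q) / ennreal (B \<nu> (\<phi> q)))"
        using k0[OF k] by blast
      \<comment> \<open>A longer range only enlarges the maxima, and the middle weight requires
        \<open>k \<le> P\<close>.\<close>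
      define P where "P = max qk k"
      have le_P: "ennreal (C j k) / ennreal (A i (S k)) \<le> ennreal K * times_top
          (MAX q\<in>{..P}. ennreal (B \<nu> q) / ennreal (A i (\<phi> q)))
          (MAX q\<in>{..P}. ennreal (C j q) / ennreal (B \<nu> (\<phi> q)))" for i j \<nu>
      proof (rule order_trans[OF qk mult_left_mono])
        have mono: "(MAX q\<in>{..qk}. f q) \<le> (MAX q\<in>{..P}. f q)" for f :: "nat \<Rightarrow> ennreal"
          by (intro Max_mono image_mono) (auto simp: P_def)
        have times_top_mono: "times_top x y \<le> times_top x' y'" if "x \<le> x'" "y \<le> y'" for x y x' y'
          using that by (auto simp: times_top_def top_unique intro: mult_mono)
        show "times_top (MAX q\<in>{..qk}. ennreal (B \<nu> q) / ennreal (A i (\<phi> q)))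
            (MAX q\<in>{..qk}. ennreal (C j q) / ennreal (B \<nu> (\<phi> q)))
          \<le> times_top (MAX q\<in>{..P}. ennreal (B \<nu> q) / ennreal (A i (\<phi> q)))
            (MAX q\<in>{..P}. ennreal (C j q) / ennreal (B \<nu> (\<phi> q)))"
          by (intro times_top_mono mono)
      qed simp
      have "\<exists>w\<ge>0.
        (\<forall>i. w = 0 \<or> (\<exists>q\<le>P. A i (\<phi> q) = 0 \<and> 0 < B \<nu> q) \<or>
          (\<exists>q\<le>P. 0 < A i (\<phi> q) \<and> 0 < B \<nu> q \<and> w * A i (\<phi> q) \<le> K * A i (S k) * B \<nu> q)) \<and>
        (\<forall>j. C j k = 0 \<or> (\<exists>q\<le>P. B \<nu> (\<phi> q) = 0 \<and> 0 < C j q) \<or>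
          (\<exists>q\<le>P. 0 < B \<nu> (\<phi> q) \<and> 0 < C j q \<and> C j k * B \<nu> (\<phi> q) \<le> w * C j q))" for \<nu>
        using le_P[of _ _ \<nu>] \<open>0 < K\<close>
        by (intro exists_middle_weight) (simp_all add: P_def kothe_matrix_nonneg A B C)
      then obtain w where w: "\<And>\<nu>. 0 \<le> w \<nu>"
        and w_A: "\<And>\<nu> i. w \<nu> = 0 \<or> (\<exists>q\<le>P. A i (\<phi> q) = 0 \<and> 0 < B \<nu> q) \<or>
          (\<exists>q\<le>P. 0 < A i (\<phi> q) \<and> 0 < B \<nu> q \<and> w \<nu> * A i (\<phi> q) \<le> K * A i (S k) * B \<nu> q)"
        and w_C: "\<And>\<nu> j. C j k = 0 \<or> (\<exists>q\<le>P. B \<nu> (\<phi> q) = 0 \<and> 0 < C j q) \<or>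
          (\<exists>q\<le>P. 0 < B \<nu> (\<phi> q) \<and> 0 < C j q \<and> C j k * B \<nu> (\<phi> q) \<le> w \<nu> * C j q)"
        by metis
      define D where "D = (\<Sum>q\<le>P. \<bar>\<Delta> q\<bar> + \<bar>\<Delta>' q\<bar>)"
      have D: "\<Delta> q \<le> D" "\<Delta>' q \<le> D" if "q \<le> P" for q
      proof -
        have "\<bar>\<Delta> q\<bar> + \<bar>\<Delta>' q\<bar> \<le> D" unfolding D_def using that by (intro member_le_sum[of q]) auto
        then show "\<Delta> q \<le> D" "\<Delta>' q \<le> D" by linarith+
      qed
      have "0 \<le> D" unfolding D_def by (intro sum_nonneg) auto
      let ?t = "\<lambda>i \<nu>. Q (unit_seq i) \<nu>" and ?u = "\<lambda>\<nu> j. R (unit_seq \<nu>) j"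
      let ?L = "interpolation_constant P * D"
      have "0 \<le> ?L" using \<open>0 \<le> D\<close> interpolation_constant_nonneg by simp
      \<comment> \<open>Applied to a unit vector with vanishing source weight, continuity forces the
        matrix entry to be zero wherever the target weight is positive. This settles the
        alternatives in which a maximum is infinite.\<close>
      have single: "norm (U (unit_seq i) \<nu>) * Y \<nu> q \<le> D * X i r"
        if "kothe_matrix X" "kothe_matrix Y" "U \<in> continuous_operators (kothe_space m X) (kothe_space m' Y)"
          and "\<And>x. x \<in> space_of (kothe_space m X :: 'k sequence_space) \<Longrightarrow>
            seminorm (kothe_space m' Y) (U x) q \<le> D * seminorm (kothe_space m X) x r"
        for X Y m m' i \<nu> q r and U :: "(nat \<Rightarrow> 'k) \<Rightarrow> nat \<Rightarrow> 'k"
      proof -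
        have unit: "unit_seq i \<in> space_of (kothe_space m X :: 'k sequence_space)"
          by (rule unit_seq_in_kothe_space[OF that(1)])
        then have "U (unit_seq i) \<in> space_of (kothe_space m' Y)"
          using that(3) by (auto simp: continuous_operators_def)
        then have "norm (U (unit_seq i) \<nu>) * Y \<nu> q \<le> seminorm (kothe_space m' Y) (U (unit_seq i)) q"
          by (rule coordinate_le_seminorm[OF that(2)])
        also have "\<dots> \<le> D * seminorm (kothe_space m X) (unit_seq i :: nat \<Rightarrow> 'k) r" by (rule that(4)[OF unit])
        finally show ?thesis by (simp add: seminorm_unit_seq[OF that(1)])
      qed
      have boundQ: "seminorm ?G (Q x) q \<le> D * seminorm ?E x (\<phi> q)" if "q \<le> P" "x \<in> space_of ?E" for q x
        using Q_bound[where \<phi> = \<phi>, OF \<phi>(1) D(1)[OF that(1)] that(2)] .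
      have boundR: "seminorm ?F (R x) q \<le> D * seminorm ?G x (\<phi> q)" if "q \<le> P" "x \<in> space_of ?G" for q x
        using R_bound[where \<phi> = \<phi>, OF \<phi>(2) D(2)[OF that(1)] that(2)] .
      have Q_mat: "matrix_bound m1 n (\<lambda>i. K * A i (S k)) m2 n' w ?t ?L" for n n'
      proof (rule matrix_bound_interpolate)
        show "matrix_bound m1 n (\<lambda>i. A i (\<phi> p)) m2 n' (\<lambda>\<nu>. B \<nu> p) ?t D" if "p \<le> P" for p
          by (intro operator_matrix_bound[OF A B Q] boundQ that)
        fix i \<nu>
        have "?t i \<nu> = 0" if "q \<le> P" "A i (\<phi> q) = 0" "0 < B \<nu> q" for q
          using single[OF A B Q boundQ[OF that(1)], of i \<nu>] that by (simp add: mult_le_0_iff)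
        then show "w \<nu> = 0 \<or> ?t i \<nu> = 0 \<or>
            (\<exists>p\<le>P. 0 < A i (\<phi> p) \<and> 0 < B \<nu> p \<and> w \<nu> * A i (\<phi> p) \<le> K * A i (S k) * B \<nu> p)"
          using w_A[of \<nu> i] by blast
      qed (use w \<open>0 \<le> D\<close> \<open>0 < K\<close> in \<open>simp_all add: kothe_matrix_nonneg A B\<close>)
      have R_mat: "matrix_bound m2 n' w m3 N (\<lambda>j. C j k) ?u ?L" for n' N
      proof (rule matrix_bound_interpolate)
        show "matrix_bound m2 n' (\<lambda>\<nu>. B \<nu> (\<phi> p)) m3 N (\<lambda>j. C j p) ?u D" if "p \<le> P" for p
          by (intro operator_matrix_bound[OF B C R] boundR that)
        fix \<nu> j
        have "?u \<nu> j = 0" if "q \<le> P" "B \<nu> (\<phi> q) = 0" "0 < C j q" for q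
          using single[OF B C R boundR[OF that(1)], of \<nu> j] that by (simp add: mult_le_0_iff)
        then show "C j k = 0 \<or> ?u \<nu> j = 0 \<or>
            (\<exists>p\<le>P. 0 < B \<nu> (\<phi> p) \<and> 0 < C j p \<and> C j k * B \<nu> (\<phi> p) \<le> w \<nu> * C j p)"
          using w_C[of j \<nu>] by blast
      qed (use w \<open>0 \<le> D\<close> in \<open>simp_all add: kothe_matrix_nonneg B C\<close>)
      have "seminorm ?F (T x) k \<le> ?L * (?L * K) * seminorm ?E x (S k)" if x: "x \<in> space_of ?E" for x
      proof -
        have Q_in: "Q y \<in> space_of ?G" if "y \<in> space_of ?E" for y
          using Q that by (auto simp: continuous_operators_def)
        have R_in: "R y \<in> space_of ?F" if "y \<in> space_of ?G" for y
          using R that by (auto simp: continuous_operators_def)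
        \<comment> \<open>Both the argument and its image under \<open>Q\<close> are truncated, as
          the matrix bounds concern finite sections. The truncation by \<open>n'\<close> is removed
          first, by density in the middle space, and then the one by \<open>n\<close>, by density in
          the first space.\<close>
        have "seminorm ?F (R (head_seq n' (Q (head_seq n x)))) k \<le> ?L * (?L * K) * seminorm ?E x (S k)" for n n'
        proof (rule seminorm_le_if_kothe_head_norm_le[OF C R_in[OF head_seq_in_kothe_space[OF B]]])
          fix N
          have "kothe_head_norm m3 C N k (R (head_seq n' (Q (head_seq n x))))
              \<le> ?L * head_norm m2 n' (\<lambda>\<nu>. norm (Q (head_seq n x) \<nu>) * w \<nu>)"
            unfolding operator_head_seq[OF B R] by (rule matrix_boundD[OF R_mat])
          also have "\<dots> \<le> ?L * (?L * head_norm m1 n (\<lambda>i. norm (x i) * (K * A i (S k))))"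
            unfolding operator_head_seq[OF A Q]
            using \<open>0 \<le> ?L\<close> by (intro mult_left_mono matrix_boundD[OF Q_mat])
          also have "(\<lambda>i. norm (x i) * (K * A i (S k))) = (\<lambda>i. K * (norm (x i) * A i (S k)))"
            by (simp add: mult_ac)
          also have "head_norm m1 n (\<lambda>i. K * (norm (x i) * A i (S k))) = K * kothe_head_norm m1 A n (S k) x"
            using \<open>0 < K\<close> by (intro head_norm_scale) simp
          also have "?L * (?L * (K * kothe_head_norm m1 A n (S k) x))
              \<le> ?L * (?L * (K * seminorm ?E x (S k)))"
            using \<open>0 \<le> ?L\<close> \<open>0 < K\<close> by (intro mult_left_mono kothe_head_norm_le_seminorm[OF A x]) auto
          finally show "kothe_head_norm m3 C N k (R (head_seq n' (Q (head_seq n x))))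
              \<le> ?L * (?L * K) * seminorm ?E x (S k)" by (simp add: mult_ac)
        qed
        then have "seminorm ?F (R (Q (head_seq n x))) k \<le> ?L * (?L * K) * seminorm ?E x (S k)" for n
          using seminorm_le_if_head_seq[OF B C m2 R Q_in[OF head_seq_in_kothe_space[OF A]]] by blast
        then have "seminorm ?F ((R \<circ> Q) x) k \<le> ?L * (?L * K) * seminorm ?E x (S k)"
          by (intro seminorm_le_if_head_seq[OF A C m1 continuous_operators_compose[OF Q R] x]) simp
        then show ?thesis by (simp add: T_eq[OF x])
      qed
      moreover have "continuity_characteristic ?E ?F T k \<le> enat (S k) \<longleftrightarrow>
          (\<exists>D. \<forall>x\<in>space_of ?E. seminorm ?F (T x) k \<le> D * seminorm ?E x (S k))"
        by (intro continuity_characteristic_le_iff E F T_lin)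
      ultimately show ?thesis by blast
    qed
    then show ?thesis by blast
  qed
  then show ?thesis unfolding tame_factorization_def using \<open>mono S\<close> by blast
qed

section \<open>Necessity\<close>

lemma kothe_l1_subset:
  fixes x :: "nat \<Rightarrow> 'k::real_normed_field"
  assumes A: "kothe_matrix A" and x: "x \<in> space_of (kothe_space L1 A)"
  shows "x \<in> space_of (kothe_space m A)"
    and "seminorm (kothe_space m A) x k \<le> seminorm (kothe_space L1 A) x k"
proof -
  have nonneg: "0 \<le> norm (x j) * A j k" for j k using A by (simp add: kothe_matrix_nonneg)
  have "kothe_head_norm m A n k x \<le> kothe_head_norm L1 A n k x" for n k
    using head_norm_le_iff[of m n "\<lambda>i. norm (x i) * A i k" "kothe_head_norm L1 A n k x"]
      le_head_norm[of _ n "\<lambda>i. norm (x i) * A i k" L1] head_norm_nonneg[of n "\<lambda>i. norm (x i) * A i k" L1]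
      nonneg by (cases "m = L1") auto
  also have "\<dots> n k \<le> seminorm (kothe_space L1 A) x k" for n k
    by (rule kothe_head_norm_le_seminorm[OF A x])
  finally have bound: "kothe_head_norm m A n k x \<le> seminorm (kothe_space L1 A) x k" for n k .
  have "(\<lambda>j. norm (x j) * A j k) \<longlonglongrightarrow> 0" for k
    using x by (intro summable_LIMSEQ_zero) (simp add: kothe_l1_def)
  with bound show "x \<in> space_of (kothe_space m A)" unfolding kothe_space_iff[OF A] by blast
  then show "seminorm (kothe_space m A) x k \<le> seminorm (kothe_space L1 A) x k"
    using bound by (rule seminorm_le_if_kothe_head_norm_le[OF A])
qed

text \<open>The sum over \<open>n\<close> of \<open>\<rho> n\<close> times the coordinate functional
  at \<open>\<sigma> n\<close> times the unit vector at \<open>\<tau> n\<close>, written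
  coordinatewise. The series at \<open>\<nu>\<close> is needed because \<open>\<tau>\<close> may
  repeat values.\<close>

definition rank_one_series ::
  "(nat \<Rightarrow> real) \<Rightarrow> (nat \<Rightarrow> nat) \<Rightarrow> (nat \<Rightarrow> nat) \<Rightarrow> (nat \<Rightarrow> 'k::real_normed_field) \<Rightarrow> nat \<Rightarrow> 'k" where
  "rank_one_series \<rho> \<sigma> \<tau> x \<nu> = (\<Sum>n. if \<tau> n = \<nu> then of_real (\<rho> n) * x (\<sigma> n) else 0)"

text \<open>In every kind of space the unit vector at \<open>\<tau> n\<close> has seminorm
  \<open>B (\<tau> n) q\<close>, and \<open>A (\<sigma> n) r\<close> times a coordinate is at most
  the seminorm \<open>r\<close>. The decay condition thus dominates the series of rank one operators
  by a geometric one, seminorm by seminorm.\<close>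

locale decaying_rank_one_series =
  fixes A B :: "nat \<Rightarrow> nat \<Rightarrow> real" and \<rho> :: "nat \<Rightarrow> real" and \<sigma> \<tau> :: "nat \<Rightarrow> nat"
  assumes A: "kothe_matrix A" and B: "kothe_matrix B" and \<rho>: "\<And>n. 0 \<le> \<rho> n"
    and decay: "\<And>q. \<exists>r D. \<forall>n. \<rho> n * B (\<tau> n) q \<le> D * (1 / 2) ^ n * A (\<sigma> n) r"
begin

lemma norm_series_bound:
  "\<exists>r D. \<forall>x :: nat \<Rightarrow> 'k::real_normed_field. x \<in> space_of (kothe_space m A) \<longrightarrow>
    summable (\<lambda>n. \<rho> n * norm (x (\<sigma> n)) * B (\<tau> n) q) \<and>
    (\<Sum>n. \<rho> n * norm (x (\<sigma> n)) * B (\<tau> n) q) \<le> D * seminorm (kothe_space m A) x r"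
proof -
  obtain r D where D: "\<And>n. \<rho> n * B (\<tau> n) q \<le> D * (1 / 2) ^ n * A (\<sigma> n) r" using decay by blast
  have "summable (\<lambda>n. \<rho> n * norm (x (\<sigma> n)) * B (\<tau> n) q) \<and>
      (\<Sum>n. \<rho> n * norm (x (\<sigma> n)) * B (\<tau> n) q) \<le> (\<bar>D\<bar> * 2) * seminorm (kothe_space m A) x r"
    if x: "x \<in> space_of (kothe_space m A)" for x :: "nat \<Rightarrow> 'k"
  proof -
    let ?N = "seminorm (kothe_space m A) x r"
    have le: "\<rho> n * norm (x (\<sigma> n)) * B (\<tau> n) q \<le> \<bar>D\<bar> * ?N * (1 / 2) ^ n" for n
    proof -
      have "norm (x (\<sigma> n)) * (\<rho> n * B (\<tau> n) q) \<le> norm (x (\<sigma> n)) * (D * (1 / 2) ^ n * A (\<sigma> n) r)"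
        by (intro mult_left_mono D) simp
      also have "\<dots> = D * ((1 / 2) ^ n * (norm (x (\<sigma> n)) * A (\<sigma> n) r))" by (simp add: mult_ac)
      also have "\<dots> \<le> \<bar>D\<bar> * ((1 / 2) ^ n * (norm (x (\<sigma> n)) * A (\<sigma> n) r))"
        using A by (intro mult_right_mono) (auto simp: kothe_matrix_nonneg)
      also have "\<dots> \<le> \<bar>D\<bar> * ((1 / 2) ^ n * ?N)"
        by (intro mult_left_mono coordinate_le_seminorm[OF A x]) auto
      finally show ?thesis by (simp add: mult_ac)
    qed
    have geometric: "(\<lambda>n. \<bar>D\<bar> * ?N * (1 / 2) ^ n) sums (\<bar>D\<bar> * ?N * 2)"
      using geometric_sums[of "1 / 2 :: real"] by (intro sums_mult) simp
    have summable: "summable (\<lambda>n. \<rho> n * norm (x (\<sigma> n)) * B (\<tau> n) q)"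
      by (rule summable_comparison_test'[OF sums_summable[OF geometric], of 0])
        (use le \<rho> B in \<open>simp add: kothe_matrix_nonneg\<close>)
    moreover have "(\<Sum>n. \<rho> n * norm (x (\<sigma> n)) * B (\<tau> n) q) \<le> \<bar>D\<bar> * ?N * 2"
      unfolding sums_unique[OF geometric]
      by (rule suminf_le[OF le summable sums_summable[OF geometric]])
    ultimately show ?thesis by (simp add: mult_ac)
  qed
  then show ?thesis by blast
qed

lemma summable_norm_coordinate:
  fixes x :: "nat \<Rightarrow> 'k::real_normed_field"
  assumes x: "x \<in> space_of (kothe_space m A)"
  shows "summable (\<lambda>n. norm (if \<tau> n = \<nu> then of_real (\<rho> n) * x (\<sigma> n) else 0))"
proof -
  obtain q where q: "0 < B \<nu> q" using kothe_matrix_pos[OF B] by blast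
  have "summable (\<lambda>n. \<rho> n * norm (x (\<sigma> n)) * B (\<tau> n) q)"
    using norm_series_bound[where 'k = 'k, of m q] x by blast
  then have "summable (\<lambda>n. \<rho> n * norm (x (\<sigma> n)) * B (\<tau> n) q * inverse (B \<nu> q))"
    by (rule summable_mult2)
  then show ?thesis
    by (rule summable_comparison_test'[of _ 0])
      (use \<rho> q B in \<open>auto simp: norm_mult kothe_matrix_nonneg mult.assoc\<close>)
qed

text \<open>Each \<open>n\<close> contributes to the single coordinate \<open>\<tau> n\<close>, so
  after exchanging the finite sum with the series at most one summand survives for each
  \<open>n\<close>.\<close>

lemma head_norm_series_le:
  fixes x :: "nat \<Rightarrow> 'k::{real_normed_field,banach}"
  assumes x: "x \<in> space_of (kothe_space m A)"
  shows "kothe_head_norm L1 B N q (rank_one_series \<rho> \<sigma> \<tau> x) \<le> (\<Sum>n. \<rho> n * norm (x (\<sigma> n)) * B (\<tau> n) q)"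
proof -
  let ?c = "\<lambda>\<nu> n. if \<tau> n = \<nu> then of_real (\<rho> n) * x (\<sigma> n) else 0"
  have summable: "summable (\<lambda>n. norm (?c \<nu> n))" for \<nu> by (rule summable_norm_coordinate[OF x])
  then have "kothe_head_norm L1 B N q (rank_one_series \<rho> \<sigma> \<tau> x) \<le> (\<Sum>\<nu><N. (\<Sum>n. norm (?c \<nu> n)) * B \<nu> q)"
    unfolding head_norm_def rank_one_series_def
    by (simp add: sum_mono mult_right_mono summable_norm kothe_matrix_nonneg[OF B])
  also have "\<dots> = (\<Sum>\<nu><N. \<Sum>n. norm (?c \<nu> n) * B \<nu> q)"
    using summable by (simp add: suminf_mult2)
  also have "\<dots> = (\<Sum>n. \<Sum>\<nu><N. norm (?c \<nu> n) * B \<nu> q)"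
    using summable by (intro suminf_sum[symmetric] summable_mult2)
  also have "\<dots> \<le> (\<Sum>n. \<rho> n * norm (x (\<sigma> n)) * B (\<tau> n) q)"
  proof (rule suminf_le)
    fix n
    have "(\<Sum>\<nu><N. norm (?c \<nu> n) * B \<nu> q)
        = (\<Sum>\<nu><N. if \<nu> = \<tau> n then \<rho> n * norm (x (\<sigma> n)) * B (\<tau> n) q else 0)"
      using \<rho> by (intro sum.cong) (auto simp: norm_mult)
    also have "\<dots> \<le> \<rho> n * norm (x (\<sigma> n)) * B (\<tau> n) q"
      using \<rho> B by (simp add: kothe_matrix_nonneg)
    finally show "(\<Sum>\<nu><N. norm (?c \<nu> n) * B \<nu> q) \<le> \<rho> n * norm (x (\<sigma> n)) * B (\<tau> n) q" .
  next
    show "summable (\<lambda>n. \<Sum>\<nu><N. norm (?c \<nu> n) * B \<nu> q)"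
      using summable by (intro summable_sum summable_mult2)
    show "summable (\<lambda>n. \<rho> n * norm (x (\<sigma> n)) * B (\<tau> n) q)"
      using norm_series_bound[where 'k = 'k, of m q] x by blast
  qed
  finally show ?thesis .
qed

text \<open>The image lies in the space of kind \<open>L1\<close> over \<open>B\<close>, with an
  estimate there. That space embeds continuously into the other two, so one proof serves every kind
  of target.\<close>

lemma continuous_operator:
  "(rank_one_series \<rho> \<sigma> \<tau> :: (nat \<Rightarrow> 'k::{real_normed_field,banach}) \<Rightarrow> nat \<Rightarrow> 'k)
    \<in> continuous_operators (kothe_space m A) (kothe_space m' B)"
proof (rule continuous_operatorsI[OF kothe_space_seminormed[OF A] kothe_space_seminormed[OF B]])
  have in_l1: "rank_one_series \<rho> \<sigma> \<tau> x \<in> space_of (kothe_space L1 B)"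
    if "x \<in> space_of (kothe_space m A)" for x :: "nat \<Rightarrow> 'k"
    unfolding kothe_space_iff[OF B] using head_norm_series_le[OF that] by blast
  then show "rank_one_series \<rho> \<sigma> \<tau> x \<in> space_of (kothe_space m' B)"
    if "x \<in> space_of (kothe_space m A)" for x :: "nat \<Rightarrow> 'k"
    using that kothe_l1_subset(1)[OF B] by blast
  have summable: "summable (\<lambda>n. if \<tau> n = \<nu> then of_real (\<rho> n) * x (\<sigma> n) else 0)"
    if "x \<in> space_of (kothe_space m A)" for x :: "nat \<Rightarrow> 'k" and \<nu>
    by (rule summable_norm_cancel[OF summable_norm_coordinate[OF that]])
  show "rank_one_series \<rho> \<sigma> \<tau> (x + y) = rank_one_series \<rho> \<sigma> \<tau> x + rank_one_series \<rho> \<sigma> \<tau> y"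
    if "x \<in> space_of (kothe_space m A)" "y \<in> space_of (kothe_space m A)" for x y :: "nat \<Rightarrow> 'k"
  proof
    fix \<nu>
    have "rank_one_series \<rho> \<sigma> \<tau> (x + y) \<nu> = (\<Sum>n. (if \<tau> n = \<nu> then of_real (\<rho> n) * x (\<sigma> n) else 0)
        + (if \<tau> n = \<nu> then of_real (\<rho> n) * y (\<sigma> n) else 0))"
      unfolding rank_one_series_def by (intro suminf_cong) (simp add: distrib_left)
    then show "rank_one_series \<rho> \<sigma> \<tau> (x + y) \<nu> = (rank_one_series \<rho> \<sigma> \<tau> x + rank_one_series \<rho> \<sigma> \<tau> y) \<nu>"
      using suminf_add[OF summable[OF that(1)] summable[OF that(2)], of \<nu> \<nu>]
      by (simp add: rank_one_series_def)
  qed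
  show "rank_one_series \<rho> \<sigma> \<tau> (scale_of (kothe_space m A) c x)
      = scale_of (kothe_space m' B) c (rank_one_series \<rho> \<sigma> \<tau> x)"
    if "x \<in> space_of (kothe_space m A)" for c and x :: "nat \<Rightarrow> 'k"
  proof
    fix \<nu>
    have "rank_one_series \<rho> \<sigma> \<tau> (\<lambda>j. c * x j) \<nu>
        = (\<Sum>n. c * (if \<tau> n = \<nu> then of_real (\<rho> n) * x (\<sigma> n) else 0))"
      unfolding rank_one_series_def by (intro suminf_cong) (simp add: mult_ac)
    also have "\<dots> = c * rank_one_series \<rho> \<sigma> \<tau> x \<nu>"
      unfolding rank_one_series_def by (rule suminf_mult[OF summable[OF that]])
    finally show "rank_one_series \<rho> \<sigma> \<tau> (scale_of (kothe_space m A) c x) \<nu>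
        = scale_of (kothe_space m' B) c (rank_one_series \<rho> \<sigma> \<tau> x) \<nu>" by simp
  qed
  show "\<exists>r D. \<forall>x\<in>space_of (kothe_space m A). seminorm (kothe_space m' B)
      (rank_one_series \<rho> \<sigma> \<tau> x :: nat \<Rightarrow> 'k) k \<le> D * seminorm (kothe_space m A) x r" for k
  proof -
    obtain r D where D: "\<And>x :: nat \<Rightarrow> 'k. x \<in> space_of (kothe_space m A) \<Longrightarrow>
        (\<Sum>n. \<rho> n * norm (x (\<sigma> n)) * B (\<tau> n) k) \<le> D * seminorm (kothe_space m A) x r"
      using norm_series_bound[where 'k = 'k, of m k] by blast
    have "seminorm (kothe_space m' B) (rank_one_series \<rho> \<sigma> \<tau> x) k \<le> D * seminorm (kothe_space m A) x r"
      if "x \<in> space_of (kothe_space m A)" for x :: "nat \<Rightarrow> 'k"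
    proof -
      have "seminorm (kothe_space L1 B) (rank_one_series \<rho> \<sigma> \<tau> x) k \<le> D * seminorm (kothe_space m A) x r"
        by (rule seminorm_le_if_kothe_head_norm_le[OF B in_l1[OF that]])
          (rule order_trans[OF head_norm_series_le[OF that] D[OF that]])
      then show ?thesis using kothe_l1_subset(2)[OF B in_l1[OF that]] order_trans by blast
    qed
    then show ?thesis by blast
  qed
qed

text \<open>Lower bounds come from positivity, which is available for real sequences; this carries
  them over to the scalar field \<open>'k\<close>.\<close>

lemma of_real_series:
  fixes y :: "nat \<Rightarrow> real"
  assumes "y \<in> space_of (kothe_space m A)"
  shows "rank_one_series \<rho> \<sigma> \<tau> (\<lambda>i. of_real (y i) :: 'k::{real_normed_field,banach})
    = (\<lambda>\<nu>. of_real (rank_one_series \<rho> \<sigma> \<tau> y \<nu>))"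
proof
  fix \<nu>
  have "summable (\<lambda>n. if \<tau> n = \<nu> then \<rho> n * y (\<sigma> n) else 0)"
    using summable_norm_cancel[OF summable_norm_coordinate[OF assms, of \<nu>]] by (simp cong: if_cong)
  from suminf_of_real[OF this, where 'a = 'k]
  have "of_real (rank_one_series \<rho> \<sigma> \<tau> y \<nu>)
      = (\<Sum>n. of_real (if \<tau> n = \<nu> then \<rho> n * y (\<sigma> n) else 0) :: 'k)"
    unfolding rank_one_series_def by (simp cong: if_cong)
  also have "\<dots> = rank_one_series \<rho> \<sigma> \<tau> (\<lambda>i. of_real (y i)) \<nu>"
    unfolding rank_one_series_def by (intro suminf_cong) simp
  finally show "rank_one_series \<rho> \<sigma> \<tau> (\<lambda>i. of_real (y i) :: 'k) \<nu>
      = of_real (rank_one_series \<rho> \<sigma> \<tau> y \<nu>)" by simp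
qed

lemma series_lower_bound:
  fixes y :: "nat \<Rightarrow> real"
  assumes y: "y \<in> space_of (kothe_space m A)" and nonneg: "\<And>i. 0 \<le> y i"
  shows "0 \<le> rank_one_series \<rho> \<sigma> \<tau> y \<nu>" and "\<rho> n * y (\<sigma> n) \<le> rank_one_series \<rho> \<sigma> \<tau> y (\<tau> n)"
proof -
  have summable: "summable (\<lambda>n. if \<tau> n = \<nu> then of_real (\<rho> n) * y (\<sigma> n) else 0)" for \<nu>
    by (rule summable_norm_cancel[OF summable_norm_coordinate[OF y]])
  show "0 \<le> rank_one_series \<rho> \<sigma> \<tau> y \<nu>"
    unfolding rank_one_series_def using \<rho> nonneg by (intro suminf_nonneg[OF summable]) simp
  show "\<rho> n * y (\<sigma> n) \<le> rank_one_series \<rho> \<sigma> \<tau> y (\<tau> n)"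
    using sum_le_suminf[OF summable[of "\<tau> n"], of "{n}"] \<rho> nonneg
    by (simp add: rank_one_series_def)
qed

end

text \<open>The coefficients are controlled at \<open>q\<close> only from \<open>n = q\<close> on.
  The finitely many earlier terms are absorbed by raising the index until
  \<open>A (\<sigma> n)\<close> is positive there, and then enlarging the constant.\<close>

lemma eventually_decay_imp_decay:
  assumes A: "kothe_matrix A" and decay: "\<And>n. q \<le> n \<Longrightarrow> \<rho> n * B (\<tau> n) q \<le> (1 / 2) ^ n * A (\<sigma> n) r"
    and nonneg: "\<And>n. 0 \<le> \<rho> n * B (\<tau> n) q"
  shows "\<exists>r D. \<forall>n. \<rho> n * B (\<tau> n) q \<le> D * (1 / 2) ^ n * A (\<sigma> n) r"
proof -
  have "\<forall>n. \<exists>k. 0 < A (\<sigma> n) k" using kothe_matrix_pos[OF A] by blast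
  then obtain s where s: "\<And>n. 0 < A (\<sigma> n) (s n)" by metis
  define r' where "r' = r + (\<Sum>n<q. s n)"
  define D where "D = 1 + (\<Sum>n<q. \<rho> n * B (\<tau> n) q / ((1 / 2) ^ n * A (\<sigma> n) r'))"
  have quotient: "0 \<le> \<rho> n * B (\<tau> n) q / ((1 / 2) ^ n * A (\<sigma> n) r')" for n
    using nonneg A by (simp add: kothe_matrix_nonneg)
  have "\<rho> n * B (\<tau> n) q \<le> D * (1 / 2) ^ n * A (\<sigma> n) r'" for n
  proof (cases "n < q")
    case True
    have "s n \<le> r'" using member_le_sum[of n "{..<q}" s] True by (simp add: r'_def)
    then have pos: "0 < A (\<sigma> n) r'" using s kothe_matrix_mono[OF A] less_le_trans by blast
    have "\<rho> n * B (\<tau> n) q / ((1 / 2) ^ n * A (\<sigma> n) r') \<le> D"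
      using member_le_sum[of n "{..<q}" "\<lambda>n. \<rho> n * B (\<tau> n) q / ((1 / 2) ^ n * A (\<sigma> n) r')"] True quotient
      by (simp add: D_def)
    then show ?thesis using pos by (simp add: pos_divide_le_eq mult.assoc)
  next
    case False
    then have "\<rho> n * B (\<tau> n) q \<le> (1 / 2) ^ n * A (\<sigma> n) r" by (intro decay) simp
    also have "\<dots> \<le> (1 / 2) ^ n * A (\<sigma> n) r'"
      by (intro mult_left_mono kothe_matrix_mono[OF A]) (auto simp: r'_def)
    also have "\<dots> \<le> D * ((1 / 2) ^ n * A (\<sigma> n) r')"
      using mult_right_mono[of 1 D "(1 / 2) ^ n * A (\<sigma> n) r'"] A sum_nonneg[of "{..<q}", OF quotient]
      by (simp add: D_def kothe_matrix_nonneg)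
    finally show ?thesis by (simp add: mult.assoc)
  qed
  then show ?thesis by blast
qed

text \<open>With \<open>\<alpha>\<close> and \<open>\<gamma>\<close> the two maxima, the constraints
  allow coefficients up to \<open>\<delta> / \<alpha>\<close> and
  \<open>\<delta> / \<gamma>\<close>, and for these the last inequality is the failure of the
  estimate, multiplied out.\<close>

lemma exists_coefficients:
  fixes a b b' c :: "nat \<Rightarrow> real" and s u K \<delta> :: real
  assumes nonneg: "\<And>q. 0 \<le> a q" "\<And>q. 0 \<le> b q" "\<And>q. 0 \<le> b' q" "\<And>q. 0 \<le> c q" "0 \<le> s" "0 \<le> u"
    and pos: "0 < K" "0 < \<delta>"
    and fails: "\<not> ennreal u / ennreal s \<le> ennreal K * times_top
      (MAX q\<in>{..P}. ennreal (b q) / ennreal (a q)) (MAX q\<in>{..P}. ennreal (c q) / ennreal (b' q))"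
  shows "\<exists>\<rho> \<sigma>. 0 < \<rho> \<and> 0 < \<sigma> \<and> (\<forall>q\<le>P. \<rho> * b q \<le> \<delta> * a q) \<and> (\<forall>q\<le>P. \<sigma> * c q \<le> \<delta> * b' q) \<and>
    K * \<delta>\<^sup>2 * s < \<rho> * \<sigma> * u"
proof -
  define \<alpha> \<gamma> where "\<alpha> = (MAX q\<in>{..P}. b q / a q)" and "\<gamma> = (MAX q\<in>{..P}. c q / b' q)"
  \<comment> \<open>An infinite factor would make the right-hand side infinite, as
    \<open>K > 0\<close>, and the estimate could not fail.\<close>
  have finite: "times_top (MAX q\<in>{..P}. ennreal (b q) / ennreal (a q))
      (MAX q\<in>{..P}. ennreal (c q) / ennreal (b' q)) \<noteq> \<infinity>"
    using fails pos by (auto simp: ennreal_mult_top)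
  then have zero: "\<And>q. q \<le> P \<Longrightarrow> a q = 0 \<Longrightarrow> b q = 0" "\<And>q. q \<le> P \<Longrightarrow> b' q = 0 \<Longrightarrow> c q = 0"
    and Max_eq: "(MAX q\<in>{..P}. ennreal (b q) / ennreal (a q)) = ennreal \<alpha>"
      "(MAX q\<in>{..P}. ennreal (c q) / ennreal (b' q)) = ennreal \<gamma>"
    using Max_ennreal_divide_cases[of b a P] Max_ennreal_divide_cases[of c b' P] nonneg
    unfolding \<alpha>_def \<gamma>_def times_top_def by auto
  have le: "b q / a q \<le> \<alpha>" "c q / b' q \<le> \<gamma>" if "q \<le> P" for q
    using that by (simp_all add: \<alpha>_def \<gamma>_def)
  have \<alpha>\<gamma>: "0 \<le> \<alpha>" "0 \<le> \<gamma>"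
    using le[of 0] nonneg by (meson divide_nonneg_nonneg le0 order_trans)+
  \<comment> \<open>The zeros anticipate a limit: strictness leaves room for a small positive
    \<open>e\<close> in their place, which keeps the coefficients finite even if
    \<open>\<alpha>\<close> or \<open>\<gamma>\<close> is zero.\<close>
  have less: "K * (\<alpha> + 0) * (\<gamma> + 0) * s < u"
  proof (rule ccontr)
    assume "\<not> ?thesis"
    then have "u \<le> K * \<alpha> * \<gamma> * s" by simp
    then have "ennreal u / ennreal s \<le> ennreal (K * (\<alpha> * \<gamma>))"
      using nonneg pos \<alpha>\<gamma> by (cases "s = 0") (auto simp: divide_ennreal less_le field_simps)
    then show False using fails \<alpha>\<gamma> pos by (simp add: Max_eq times_top_def ennreal_mult)
  qed
  have "((\<lambda>e. K * (\<alpha> + e) * (\<gamma> + e) * s) \<longlongrightarrow> K * (\<alpha> + 0) * (\<gamma> + 0) * s) (at_right 0)"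
    by (intro tendsto_intros)
  then have "\<forall>\<^sub>F e in at_right 0. 0 < e \<and> K * (\<alpha> + e) * (\<gamma> + e) * s < u"
    using less by (intro eventually_conj eventually_at_right_less) (rule order_tendstoD(2))
  then obtain e where e: "0 < e" "K * (\<alpha> + e) * (\<gamma> + e) * s < u"
    using eventually_happens'[OF trivial_limit_at_right_real] by blast
  have dominated: "\<delta> / (\<mu> + e) * f q \<le> \<delta> * g q"
    if "f q / g q \<le> \<mu>" "g q = 0 \<longrightarrow> f q = 0" "0 \<le> g q" "0 \<le> \<mu>" for f g :: "nat \<Rightarrow> real" and q \<mu>
  proof (cases "g q = 0")
    case False
    then have "f q \<le> \<mu> * g q" using that by (simp add: field_simps less_le)
    also have "\<dots> \<le> (\<mu> + e) * g q" using that e by (intro mult_right_mono) auto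
    finally have "f q / (\<mu> + e) \<le> g q" using that e by (simp add: pos_divide_le_eq mult.commute)
    then have "\<delta> * (f q / (\<mu> + e)) \<le> \<delta> * g q" using pos by (intro mult_left_mono) auto
    then show ?thesis by simp
  qed (use that in simp)
  have "K * \<delta>\<^sup>2 * s < \<delta> / (\<alpha> + e) * (\<delta> / (\<gamma> + e)) * u"
  proof -
    have "0 < (\<alpha> + e) * (\<gamma> + e)" using e \<alpha>\<gamma> by simp
    moreover have "K * s * ((\<alpha> + e) * (\<gamma> + e)) < u" using e(2) by (simp add: mult_ac)
    ultimately have "K * s < u / ((\<alpha> + e) * (\<gamma> + e))" by (simp add: pos_less_divide_eq)
    then have "\<delta>\<^sup>2 * (K * s) < \<delta>\<^sup>2 * (u / ((\<alpha> + e) * (\<gamma> + e)))"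
      using pos by (intro mult_strict_left_mono) auto
    then show ?thesis by (simp add: power2_eq_square mult_ac)
  qed
  moreover have "\<delta> / (\<alpha> + e) * b q \<le> \<delta> * a q" "\<delta> / (\<gamma> + e) * c q \<le> \<delta> * b' q" if "q \<le> P" for q
    using le[OF that] zero[OF that] nonneg \<alpha>\<gamma> by (intro dominated; blast)+
  moreover have "0 < \<delta> / (\<alpha> + e)" "0 < \<delta> / (\<gamma> + e)" using e(1) pos(2) \<alpha>\<gamma> by simp_all
  ultimately show ?thesis by blast
qed

text \<open>The same \<open>S\<close> is kept. If some \<open>\<phi>\<close> defeats it, then at
  arbitrarily large \<open>k\<close> the inequality fails for every length and constant. Each such
  failure supplies an index triple and two coefficients, and the resulting operator, tested on one
  unit vector, exceeds any prescribed constant at a bad \<open>k\<close>.\<close>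

theorem matrix_condition_if_tame_factorization:
  fixes A B C :: "nat \<Rightarrow> nat \<Rightarrow> real"
  assumes A: "kothe_matrix A" and B: "kothe_matrix B" and C: "kothe_matrix C"
    and tame: "tame_factorization (kothe_space m1 A :: 'k::{real_normed_field,banach} sequence_space)
      (kothe_space m2 B) (kothe_space m3 C)"
  shows "tame_matrix_condition A B C"
proof -
  let ?E = "kothe_space m1 A :: 'k sequence_space" and ?G = "kothe_space m2 B :: 'k sequence_space"
    and ?F = "kothe_space m3 C :: 'k sequence_space"
  obtain S :: "nat \<Rightarrow> nat" where "mono S" and S: "\<And>T. T \<in> operators_through ?E ?G ?F \<Longrightarrow>
      \<exists>k0. \<forall>k\<ge>k0. continuity_characteristic ?E ?F T k \<le> enat (S k)"
    using tame unfolding tame_factorization_def by blast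
  define bound where "bound \<phi> k qk Ck i j \<nu> \<longleftrightarrow> ennreal (C j k) / ennreal (A i (S k)) \<le> ennreal Ck * times_top
      (MAX q\<in>{..qk}. ennreal (B \<nu> q) / ennreal (A i (\<phi> q)))
      (MAX q\<in>{..qk}. ennreal (C j q) / ennreal (B \<nu> (\<phi> q)))"
    for \<phi> :: "nat \<Rightarrow> nat" and k qk :: nat and Ck :: real and i j \<nu>
  have "\<exists>k0. \<forall>k\<ge>k0. \<exists>qk Ck. 0 < Ck \<and> (\<forall>i j \<nu>. bound \<phi> k qk Ck i j \<nu>)" for \<phi>
  proof (rule ccontr)
    assume fails: "\<not> ?thesis"
    have "\<exists>k\<ge>k0. \<forall>qk Ck. 0 < Ck \<longrightarrow> (\<exists>i j \<nu>. \<not> bound \<phi> k qk Ck i j \<nu>)" for k0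
    proof (rule ccontr)
      assume "\<not> ?thesis"
      then have "\<forall>k\<ge>k0. \<exists>qk Ck. 0 < Ck \<and> (\<forall>i j \<nu>. bound \<phi> k qk Ck i j \<nu>)" by simp
      with fails show False by blast
    qed
    then obtain f where f: "\<And>k0. k0 \<le> f k0"
      and bad: "\<And>k0 qk Ck. 0 < Ck \<Longrightarrow> \<exists>i j \<nu>. \<not> bound \<phi> (f k0) qk Ck i j \<nu>"
      by metis
    txt \<open>Every value of \<open>f\<close> is attained by \<open>\<kappa>\<close> infinitely often.\<close>
    define \<kappa> where "\<kappa> n = f (fst (prod_decode n))" for n
    \<comment> \<open>\<open>4 ^ n\<close> compensates the two decay factors
      \<open>(1 / 2) ^ n\<close>; what remains, \<open>Suc n\<close>, is the unbounded
      excess.\<close>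
    define K :: "nat \<Rightarrow> real" where "K n = real (Suc n) * 4 ^ n" for n
    have K: "0 < K n" "K n * ((1 / 2) ^ n)\<^sup>2 = real (Suc n)" for n
      by (simp_all add: K_def power2_eq_square power_mult_distrib[symmetric])
    have "\<exists>i j \<nu>. \<not> bound \<phi> (\<kappa> n) n (K n) i j \<nu>" for n
      unfolding \<kappa>_def using K by (intro bad)
    then obtain i j \<nu> where "\<And>n. \<not> bound \<phi> (\<kappa> n) n (K n) (i n) (j n) (\<nu> n)" by metis
    then have "\<exists>\<rho> \<sigma>. 0 < \<rho> \<and> 0 < \<sigma> \<and> (\<forall>q\<le>n. \<rho> * B (\<nu> n) q \<le> (1 / 2) ^ n * A (i n) (\<phi> q)) \<and>
        (\<forall>q\<le>n. \<sigma> * C (j n) q \<le> (1 / 2) ^ n * B (\<nu> n) (\<phi> q)) \<and>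
        K n * ((1 / 2) ^ n)\<^sup>2 * A (i n) (S (\<kappa> n)) < \<rho> * \<sigma> * C (j n) (\<kappa> n)" for n
      using K(1)[of n] unfolding bound_def
      by (intro exists_coefficients) (auto simp: kothe_matrix_nonneg A B C)
    then obtain \<rho> \<sigma> where pos: "\<And>n. 0 < \<rho> n" "\<And>n. 0 < \<sigma> n"
      and \<rho>: "\<And>n q. q \<le> n \<Longrightarrow> \<rho> n * B (\<nu> n) q \<le> (1 / 2) ^ n * A (i n) (\<phi> q)"
      and \<sigma>: "\<And>n q. q \<le> n \<Longrightarrow> \<sigma> n * C (j n) q \<le> (1 / 2) ^ n * B (\<nu> n) (\<phi> q)"
      and large: "\<And>n. real (Suc n) * A (i n) (S (\<kappa> n)) < \<rho> n * \<sigma> n * C (j n) (\<kappa> n)"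
      unfolding K(2) by metis
    have less_imp: "0 \<le> \<rho> n" "0 \<le> \<sigma> n" for n using pos by (simp_all add: less_imp_le)
    interpret Q: decaying_rank_one_series A B \<rho> i \<nu>
      by unfold_locales (auto intro!: A B less_imp eventually_decay_imp_decay \<rho> simp: less_imp kothe_matrix_nonneg[OF B])
    interpret R: decaying_rank_one_series B C \<sigma> \<nu> j
      by unfold_locales (auto intro!: B C less_imp eventually_decay_imp_decay \<sigma> simp: less_imp kothe_matrix_nonneg[OF C])
    define T :: "(nat \<Rightarrow> 'k) \<Rightarrow> nat \<Rightarrow> 'k" where "T = rank_one_series \<sigma> \<nu> j \<circ> rank_one_series \<rho> i \<nu>"
    have T: "T \<in> continuous_operators ?E ?F"
      unfolding T_def by (rule continuous_operators_compose[OF Q.continuous_operator R.continuous_operator[of m2]])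
    have "T \<in> operators_through ?E ?G ?F"
      unfolding operators_through_def
      by (rule CollectI, intro conjI T bexI[OF _ Q.continuous_operator] bexI[OF _ R.continuous_operator])
        (simp add: T_def)
    then obtain k0 where "\<And>k. k0 \<le> k \<Longrightarrow> continuity_characteristic ?E ?F T k \<le> enat (S k)"
      using S by blast
    then have "continuity_characteristic ?E ?F T (f k0) \<le> enat (S (f k0))" using f by blast
    then obtain D where D: "\<And>x. x \<in> space_of ?E \<Longrightarrow>
        seminorm ?F (T x) (f k0) \<le> D * seminorm ?E x (S (f k0))"
      using T by (subst (asm) continuity_characteristic_le_iff)
        (auto simp: kothe_space_seminormed A C continuous_operators_def)
    obtain N :: nat where N: "D \<le> real N" using real_arch_simple by blast
    \<comment> \<open>This \<open>n\<close> tests the bad index \<open>f k0\<close>, while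
      \<open>N \<le> n\<close> puts the excess \<open>Suc n\<close> above the constant
      \<open>D\<close>.\<close>
    define n where "n = prod_encode (k0, N)"
    have n: "\<kappa> n = f k0" "N \<le> n" by (simp_all add: \<kappa>_def n_def le_prod_encode_2)
    define e :: "nat \<Rightarrow> real" where "e = unit_seq (i n)"
    define y where "y = rank_one_series \<rho> i \<nu> e"
    have e: "e \<in> space_of (kothe_space m1 A)" unfolding e_def by (rule unit_seq_in_kothe_space[OF A])
    then have y: "y \<in> space_of (kothe_space m2 B)"
      using Q.continuous_operator[where 'k = real, of m1 m2] by (auto simp: y_def continuous_operators_def)
    have e_nonneg: "0 \<le> e i" for i by (simp add: e_def unit_seq_def)
    have y_nonneg: "0 \<le> y \<nu>" for \<nu> unfolding y_def by (rule Q.series_lower_bound(1)[OF e e_nonneg])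
    \<comment> \<open>Other terms of the series may hit the same coordinates, but they only add
      nonnegative amounts, so no disjointness of the chosen indices is required.\<close>
    have "\<rho> n \<le> y (\<nu> n)"
      using Q.series_lower_bound(2)[OF e e_nonneg, of n] by (simp add: y_def e_def unit_seq_def)
    then have "\<sigma> n * \<rho> n \<le> \<sigma> n * y (\<nu> n)" using less_imp by (intro mult_left_mono)
    also have "\<dots> \<le> rank_one_series \<sigma> \<nu> j y (j n)" by (rule R.series_lower_bound(2)[OF y y_nonneg])
    finally have lower: "\<rho> n * \<sigma> n \<le> rank_one_series \<sigma> \<nu> j y (j n)" by (simp add: mult.commute)
    have "unit_seq (i n) = (\<lambda>l. of_real (e l) :: 'k)" by (simp add: e_def unit_seq_def fun_eq_iff)
    then have T_unit: "T (unit_seq (i n)) = (\<lambda>l. of_real (rank_one_series \<sigma> \<nu> j y l))"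
      by (simp add: T_def Q.of_real_series[OF e] R.of_real_series[OF y] y_def[symmetric])
    have unit: "unit_seq (i n) \<in> space_of ?E" by (rule unit_seq_in_kothe_space[OF A])
    then have "T (unit_seq (i n)) \<in> space_of ?F" using T by (auto simp: continuous_operators_def)
    from coordinate_le_seminorm[OF C this, of "j n" "f k0"]
    have "rank_one_series \<sigma> \<nu> j y (j n) * C (j n) (f k0) \<le> seminorm ?F (T (unit_seq (i n))) (f k0)"
      using R.series_lower_bound(1)[OF y y_nonneg] by (simp add: T_unit)
    also have "\<dots> \<le> D * A (i n) (S (f k0))"
      using D[OF unit] by (simp add: seminorm_unit_seq[OF A])
    also have "\<dots> \<le> real (Suc n) * A (i n) (S (f k0))"
      using N n(2) by (intro mult_right_mono) (auto simp: kothe_matrix_nonneg A)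
    also have "\<dots> < \<rho> n * \<sigma> n * C (j n) (f k0)" using large[of n] n(1) by simp
    also have "\<dots> \<le> rank_one_series \<sigma> \<nu> j y (j n) * C (j n) (f k0)"
      using lower C by (intro mult_right_mono) (auto simp: kothe_matrix_nonneg)
    finally show False by simp
  qed
  then show ?thesis using \<open>mono S\<close> unfolding tame_matrix_condition_def bound_def by blast
qed

theorem theorem4p4:
  fixes A B C :: "nat \<Rightarrow> nat \<Rightarrow> real" and m1 m2 m3 :: kothe_kind
  assumes "kothe_matrix A" and "kothe_matrix B" and "kothe_matrix C"
    and "m1 \<in> {L1, C0}" and "m2 \<in> {L1, C0}" and "m3 \<in> {L1, Linf}"
  shows
    "(tame_factorization
        (kothe_space m1 A :: real sequence_space)
        (kothe_space m2 B :: real sequence_space)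
        (kothe_space m3 C :: real sequence_space)
      \<longleftrightarrow> tame_matrix_condition A B C) \<and>
     (tame_factorization
        (kothe_space m1 A :: complex sequence_space)
        (kothe_space m2 B :: complex sequence_space)
        (kothe_space m3 C :: complex sequence_space)
      \<longleftrightarrow> tame_matrix_condition A B C)"
proof -
  have "m1 \<noteq> Linf" "m2 \<noteq> Linf" using assms(4,5) by auto
  note sufficient = tame_factorization_if_matrix_condition[OF assms(1-3) this]
    and necessary = matrix_condition_if_tame_factorization[OF assms(1-3)]
  show ?thesis
    by (intro conjI iffI) (erule necessary sufficient)+
qed

end
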